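(* Let $n, N_1, N_2, k$ be positive integers with $r := N_1 - n > 0$ and $N_2 = rk$. Let $\gamma(t,x)$ be a polynomial map from $\mathbb{R}^n \times \mathbb{R}^{N_2}$ into $\mathbb{R}^{N_1}$, and let $\omega$, $\Phi_x$ and $T$ be the $r$-form, the functional and the operator associated to $\gamma$ and to a set $\widetilde\Omega$ as defined in the context. Fix any real $s, \delta > 0$ and suppose that $\widetilde\Omega \subset \mathbb{R}^n \times \mathbb{R}^{N_2}$ is a Borel set such that $$\int_{E^k} |\Phi_x(t_1,\ldots,t_k)| \, dt_1 \cdots dt_k \geq \delta |E|^{k+s}$$ for every point $x \in \mathbb{R}^{N_2}$ and every Borel set $E \subset \mathbb{R}^n$ such that $E \times \{x\} \subset \widetilde\Omega$. Then $$\| T \chi_F \|_{L^{k+s}(\mathbb{R}^{N_2})} \leq C\, \delta^{-\frac{1}{k+s}} |F|^{\frac{k}{k+s}}$$ for all Borel sets $F \subset \mathbb{R}^{N_1}$, where the finite constant $C$ depends only on $(n, N_1, N_2, s, \deg\gamma)$.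
   Context: $|E|$ denotes Lebesgue measure and $\chi_F$ the indicator function of $F$. The Radon-like operator $T$ associated to $\gamma$ and $\widetilde\Omega$ is $$T f(x) := \int_{\mathbb{R}^n} f(\gamma(t,x)) \, \chi_{\widetilde\Omega}(t,x) \, dt, \qquad x \in \mathbb{R}^{N_2}.$$ The $r$-form $\omega$ (in the variables $x$) is $$\omega(t,x) := \sum_{1 \leq i_1 < \cdots < i_r \leq N_2} \det\left[ \frac{\partial\gamma}{\partial x_{i_1}}(t,x) \ \cdots \ \frac{\partial\gamma}{\partial x_{i_r}}(t,x) \ \ \frac{\partial\gamma}{\partial t}(t,x) \right] dx_{i_1} \wedge \cdots \wedge dx_{i_r},$$ where each $\partial\gamma/\partial x_{i_j}$ is an $N_1 \times 1$ column of partial derivatives, $\partial\gamma/\partial t$ is the $N_1 \times n$ Jacobian matrix of $\gamma$ with respect to $t$, and the determinant is that of the $N_1 \times N_1$ matrix formed by concatenation. For each $x \in \mathbb{R}^{N_2}$, $$\Phi_x(t_1,\ldots,t_k) := \frac{\omega(t_1,x) \wedge \cdots \wedge \omega(t_k,x)}{dx_1 \wedge \cdots \wedge dx_{N_2}},$$ which is a well-defined real number because numerator and denominator belong to the same one-dimensional space of $N_2$-forms on $\mathbb{R}^{N_2}$. *)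

theory Defs
  imports "HOL-Analysis.Analysis"
begin

(* Real powers on [0,\<infinity>]; only meant for exponents p > 0, where \<infinity>^p = \<infinity> and 0^p = 0. *)
definition epowr :: "ennreal \<Rightarrow> real \<Rightarrow> ennreal" where
  "epowr x p = (if x = top then top else ennreal (enn2real x powr p))"

(* For p > 0.  The function takes values in [0,\<infinity>], so it plays the role of the modulus
   of the function whose L^p(dx) norm is taken. *)
definition Lp_norm :: "real \<Rightarrow> ('a::euclidean_space \<Rightarrow> ennreal) \<Rightarrow> ennreal" where
  "Lp_norm p g = epowr (\<integral>\<^sup>+ x. epowr (g x) p \<partial>lborel) (1 / p)"

(* p z = sum of c_a z^a over the multi-indices a (one exponent per standard coordinate)
   with |a| \<le> d, the coefficients c_a being vectors. *)
definition poly_of_degree_le :: "nat \<Rightarrow> ('a::euclidean_space \<Rightarrow> 'b::real_vector) \<Rightarrow> bool" where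
  "poly_of_degree_le d p \<longleftrightarrow>
     (\<exists>c. \<forall>z. p z = (\<Sum>a \<in> {a \<in> Basis \<rightarrow>\<^sub>E {..d}. (\<Sum>b\<in>Basis. a b) \<le> d}.
                        (\<Prod>b\<in>Basis. (z \<bullet> b) ^ a b) *\<^sub>R c a))"

(* Total degree of a polynomial map, i.e. the maximum of the degrees of its components
   (and 0 for the zero map).  Meaningful for polynomial functions only. *)
definition poly_map_degree :: "('a::euclidean_space \<Rightarrow> 'b::real_vector) \<Rightarrow> nat" where
  "poly_map_degree p = (LEAST d. poly_of_degree_le d p)"


(* A constant-coefficient differential form on R^'b is represented by its coefficients in the
   basis dx_I = dx_{i_1} \<and> ... \<and> dx_{i_m}, where I = {i_1 < ... < i_m} is a set of indices. *)
type_synonym 'b form = "'b set \<Rightarrow> real"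

definition dx :: "'b set \<Rightarrow> 'b form" where
  "dx I = (\<lambda>K. if K = I then 1 else 0)"

definition inversions :: "'b::linorder set \<Rightarrow> 'b set \<Rightarrow> nat" where
  "inversions I J = card {(i, j). i \<in> I \<and> j \<in> J \<and> j < i}"

(* The bilinear extension of dx_I \<and> dx_J = (-1)^(inversions I J) dx_(I \<union> J) for disjoint I, J
   and dx_I \<and> dx_J = 0 otherwise; see the lemmas below. *)
definition wedge :: "'b::{finite,linorder} form \<Rightarrow> 'b form \<Rightarrow> 'b form" where
  "wedge \<alpha> \<beta> = (\<lambda>K. \<Sum>I\<in>Pow K. (- 1) ^ inversions I (K - I) * \<alpha> I * \<beta> (K - I))"

lemma wedge_dx_disjoint:
  assumes "I \<inter> J = {}"
  shows "wedge (dx I) (dx J) = (\<lambda>K. (- 1) ^ inversions I J * dx (I \<union> J) K)"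
proof
  fix K
  have "wedge (dx I) (dx J) K =
      (\<Sum>L\<in>Pow K. if L = I then (- 1) ^ inversions I (K - I) * dx J (K - I) else 0)"
    unfolding wedge_def by (intro sum.cong) (auto simp: dx_def)
  also have "\<dots> = (if I \<subseteq> K then (- 1) ^ inversions I (K - I) * dx J (K - I) else 0)"
    by simp
  also have "\<dots> = (- 1) ^ inversions I J * dx (I \<union> J) K"
  proof (cases "K = I \<union> J")
    case True
    then have "K - I = J" using assms by blast
    then show ?thesis using True by (auto simp: dx_def)
  next
    case False
    then have "I \<subseteq> K \<Longrightarrow> K - I \<noteq> J" by blast
    then show ?thesis using False by (cases "I \<subseteq> K") (simp_all add: dx_def)
  qed
  finally show "wedge (dx I) (dx J) K = (- 1) ^ inversions I J * dx (I \<union> J) K" .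
qed

lemma wedge_dx_overlap:
  assumes "I \<inter> J \<noteq> {}"
  shows "wedge (dx I) (dx J) = (\<lambda>K. 0)"
proof
  fix K
  have "dx I L * dx J (K - L) = 0" for L
    using assms by (auto simp: dx_def)
  then show "wedge (dx I) (dx J) K = 0"
    unfolding wedge_def by (intro sum.neutral) (auto simp: mult.assoc)
qed

lemma wedge_dx_singleton_less:
  assumes "i < j"
  shows "wedge (dx {i}) (dx {j}) = dx {i, j}"
    and "wedge (dx {j}) (dx {i}) = (\<lambda>K. - dx {i, j} K)"
proof -
  have e: "{(a, b). a \<in> {i} \<and> b \<in> {j} \<and> b < a} = {}"
       "{(a, b). a \<in> {j} \<and> b \<in> {i} \<and> b < a} = {(j, i)}"
    using assms by auto
  have "inversions {i} {j} = 0" "inversions {j} {i} = 1"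
    unfolding inversions_def e by simp_all
  then show "wedge (dx {i}) (dx {j}) = dx {i, j}"
      "wedge (dx {j}) (dx {i}) = (\<lambda>K. - dx {i, j} K)"
    using assms by (auto simp: wedge_dx_disjoint insert_commute)
qed

(* \<alpha>_1 \<and> ... \<and> \<alpha>_m; the empty product is the constant 0-form 1 = dx_{}. *)
definition wedge_list :: "'b::{finite,linorder} form list \<Rightarrow> 'b form" where
  "wedge_list fs = foldr wedge fs (dx {})"


(* The variables are z = (t, x) with t in R^n = 'n rvec, x in R^N2 = 'b rvec and values in
   R^N1 = 'm rvec (the types real^'n etc.); the orders on the finite index types provide the numbering of coordinates. *)

type_synonym 'n rvec = "(real, 'n) vec"

definition partial_t ::
  "('n::finite rvec \<times> 'b::finite rvec \<Rightarrow> 'm::finite rvec) \<Rightarrow> 'n \<Rightarrow> 'n rvec \<Rightarrow> 'b rvec \<Rightarrow> 'm rvec" where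
  "partial_t \<gamma> l t x = vector_derivative (\<lambda>h. \<gamma> (t + h *\<^sub>R axis l 1, x)) (at 0)"

definition partial_x ::
  "('n::finite rvec \<times> 'b::finite rvec \<Rightarrow> 'm::finite rvec) \<Rightarrow> 'b \<Rightarrow> 'n rvec \<Rightarrow> 'b rvec \<Rightarrow> 'm rvec" where
  "partial_x \<gamma> i t x = vector_derivative (\<lambda>h. \<gamma> (t, x + h *\<^sub>R axis i 1)) (at 0)"

(* 0-based position of an index, and the index at a given position of a set of indices. *)
definition pos :: "'a::{finite,linorder} \<Rightarrow> nat" where
  "pos j = card {i. i < j}"

definition nth_index :: "'a::{finite,linorder} set \<Rightarrow> nat \<Rightarrow> 'a" where
  "nth_index I p = sorted_list_of_set I ! p"

(* For I = {i_1 < ... < i_r} with r = N1 - n: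
   columns d\<gamma>/dx_{i_1}, ..., d\<gamma>/dx_{i_r}, d\<gamma>/dt_1, ..., d\<gamma>/dt_n. *)
definition omega_matrix ::
  "('n::{finite,linorder} rvec \<times> 'b::{finite,linorder} rvec \<Rightarrow> 'm::{finite,linorder} rvec)
     \<Rightarrow> 'n rvec \<Rightarrow> 'b rvec \<Rightarrow> 'b set \<Rightarrow> ('m rvec, 'm) vec" where
  "omega_matrix \<gamma> t x I =
     (let r = CARD('m) - CARD('n) in
      \<chi> row col.
        (if pos col < r then partial_x \<gamma> (nth_index I (pos col)) t x
         else partial_t \<gamma> (nth_index UNIV (pos col - r)) t x) $ row)"

definition omega ::
  "('n::{finite,linorder} rvec \<times> 'b::{finite,linorder} rvec \<Rightarrow> 'm::{finite,linorder} rvec)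
     \<Rightarrow> 'n rvec \<Rightarrow> 'b rvec \<Rightarrow> 'b form" where
  "omega \<gamma> t x =
     (\<lambda>I. if card I = CARD('m) - CARD('n) then det (omega_matrix \<gamma> t x I) else 0)"

(* Points (t_1, ..., t_k) of (R^n)^k are functions t on {..<k}.  Dividing an N2-form by
   dx_1 \<and> ... \<and> dx_N2 = dx UNIV amounts to taking its coefficient at UNIV. *)
definition Phi ::
  "('n::{finite,linorder} rvec \<times> 'b::{finite,linorder} rvec \<Rightarrow> 'm::{finite,linorder} rvec)
     \<Rightarrow> nat \<Rightarrow> 'b rvec \<Rightarrow> (nat \<Rightarrow> 'n rvec) \<Rightarrow> real" where
  "Phi \<gamma> k x t = wedge_list (map (\<lambda>j. omega \<gamma> (t j) x) [0..<k]) UNIV"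

(* The operator T on functions with values in [0,\<infinity>]. *)
definition radon_op ::
  "('n::finite rvec \<times> 'b::finite rvec \<Rightarrow> 'm::finite rvec) \<Rightarrow> ('n rvec \<times> 'b rvec) set
     \<Rightarrow> ('m rvec \<Rightarrow> ennreal) \<Rightarrow> 'b rvec \<Rightarrow> ennreal" where
  "radon_op \<gamma> \<Omega> f x = (\<integral>\<^sup>+ t. f (\<gamma> (t, x)) * indicator \<Omega> (t, x) \<partial>lborel)"

end

theory Submission
  imports Defs
begin

text \<open>Write \<open>E\<^sub>x = {t. (t, x) \<in> \<Omega> \<and> \<gamma>(t, x) \<in> F}\<close>, so that \<open>T\<chi>\<^sub>F(x) = |E\<^sub>x|\<close>.  The hypothesis for \<open>E = E\<^sub>x\<close>,
  integrated in \<open>x\<close>, bounds \<open>\<delta> \<integral> |E\<^sub>x|\<^bsup>k+s\<^esup> dx\<close> by the integral of \<open>|\<Phi>\<^sub>x(t\<^sub>1, \<dots>, t\<^sub>k)|\<close> over all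
  \<open>(x, t\<^sub>1, \<dots>, t\<^sub>k)\<close> that the configuration map
  \<open>\<Psi>(x, t\<^sub>1, \<dots>, t\<^sub>k) = (\<gamma>(t\<^sub>1, x), \<dots>, \<gamma>(t\<^sub>k, x))\<close> sends to \<open>F\<^bsup>k\<^esup>\<close>.  Since \<open>N\<^sub>2 + n k = N\<^sub>1 k\<close>, this map goes between
  spaces of the same dimension, and \<open>\<Phi>\<close> is its Jacobian determinant up to sign
  (\<open>abs_det_configuration_deriv\<close>).  By the area formula the integral is that of the number of preimages
  under \<open>\<Psi>\<close> over \<open>F\<^bsup>k\<^esup>\<close> (\<open>nn_integral_Jacobian_le\<close>), hence at most a constant times \<open>|F|\<^bsup>k\<^esup>\<close> as soon as almost all
  fibres of \<open>\<Psi>\<close> are bounded in size; the estimate follows on taking the power \<open>1 / (k + s)\<close>.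

  A Bezout-type bound for the fibres is needed only up to null sets, and for this linear algebra
  is enough.  Each coordinate of the point satisfies a nontrivial polynomial relation with the components of
  \<open>\<Psi>\<close>, of a degree that depends only on the dimension and on the degree of \<open>\<Psi>\<close>, because there are
  more products of their powers than monomials to express them
  (\<open>polynomials_algebraically_dependent\<close>).  Over almost every \<open>y\<close> the relation remains nontrivial after
  inserting \<open>y\<close>, and leaves boundedly many values for the coordinate (\<open>AE_card_fibre_le\<close>).

  The identity for the Jacobian is a Laplace expansion along blocks of rows.  It comes from the exterior
  algebra: a determinant is the wedge product of its rows (\<open>det_eq_wedge_list_covector\<close>), this
  product may be bracketed block by block by associativity, and the columns of \<open>t\<^sub>j\<close> occur only in block \<open>j\<close>, so
  that they can be split off from each factor at the cost of a sign (\<open>wedge_list_block_form\<close>).\<close>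

section \<open>The exterior algebra\<close>

lemma inversions_empty [simp]: "inversions {} J = 0"
  by (simp_all add: inversions_def)

lemma inversions_Un_left:
  fixes I :: "'c::{finite,linorder} set"
  assumes "I \<inter> J = {}"
  shows "inversions (I \<union> J) K = inversions I K + inversions J K"
proof -
  have "{(i, j). i \<in> I \<union> J \<and> j \<in> K \<and> j < i} =
      {(i, j). i \<in> I \<and> j \<in> K \<and> j < i} \<union> {(i, j). i \<in> J \<and> j \<in> K \<and> j < i}"
    by auto
  then show ?thesis
    unfolding inversions_def using assms by (simp, intro card_Un_disjoint) auto
qed

lemma inversions_Un_right:
  fixes I :: "'c::{finite,linorder} set"
  assumes "J \<inter> K = {}"
  shows "inversions I (J \<union> K) = inversions I J + inversions I K"
proof -
  have "{(i, j). i \<in> I \<and> j \<in> J \<union> K \<and> j < i} =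
      {(i, j). i \<in> I \<and> j \<in> J \<and> j < i} \<union> {(i, j). i \<in> I \<and> j \<in> K \<and> j < i}"
    by auto
  then show ?thesis
    unfolding inversions_def using assms by (simp, intro card_Un_disjoint) auto
qed

lemma inversions_ordered:
  assumes "\<And>i j. i \<in> I \<Longrightarrow> j \<in> J \<Longrightarrow> i < j"
  shows "inversions I J = 0"
proof -
  have "{(i, j). i \<in> I \<and> j \<in> J \<and> j < i} = {}"
    using assms by (force dest: less_asym)
  then show ?thesis by (simp only: inversions_def card.empty)
qed

lemma inversions_reverse_ordered:
  fixes I :: "'c::{finite,linorder} set"
  assumes "\<And>i j. i \<in> I \<Longrightarrow> j \<in> J \<Longrightarrow> j < i"
  shows "inversions I J = card I * card J"
proof -
  have "{(i, j). i \<in> I \<and> j \<in> J \<and> j < i} = I \<times> J"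
    using assms by auto
  then show ?thesis by (simp add: inversions_def)
qed

lemma inversions_swap:
  fixes I :: "'c::{finite,linorder} set"
  assumes "I \<inter> J = {}"
  shows "inversions I J + inversions J I = card I * card J"
proof -
  have "inversions J I = card ((\<lambda>(i, j). (j, i)) ` {(i, j). i \<in> J \<and> j \<in> I \<and> j < i})"
    unfolding inversions_def by (intro card_image[symmetric]) (auto simp: inj_on_def)
  also have "\<dots> = card {(i, j). i \<in> I \<and> j \<in> J \<and> i < j}"
    by (rule arg_cong[of _ _ card]) (auto simp: image_iff)
  finally have "inversions I J + inversions J I =
      card ({(i, j). i \<in> I \<and> j \<in> J \<and> j < i} \<union> {(i, j). i \<in> I \<and> j \<in> J \<and> i < j})"
    unfolding inversions_def by (subst card_Un_disjoint) auto
  also have "{(i, j). i \<in> I \<and> j \<in> J \<and> j < i} \<union> {(i, j). i \<in> I \<and> j \<in> J \<and> i < j} = I \<times> J"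
    using assms by (auto simp: neq_iff)
  finally show ?thesis by simp
qed

lemma inversions_image:
  assumes "strict_mono f"
  shows "inversions (f ` I) (f ` J) = inversions I J"
proof -
  have "{(i, j). i \<in> f ` I \<and> j \<in> f ` J \<and> j < i} = map_prod f f ` {(i, j). i \<in> I \<and> j \<in> J \<and> j < i}"
    using strict_mono_less[OF assms] by (auto simp: image_iff)
  moreover have "inj_on (map_prod f f) A" for A
    using strict_mono_eq[OF assms] by (auto simp: inj_on_def)
  ultimately show ?thesis
    by (simp add: inversions_def card_image)
qed

text \<open>Both triple products sum over the ordered partitions of \<open>K\<close> into three parts, and the sign
  of a partition counts the inversions between each pair of its parts, however they are bracketed.\<close>

lemma wedge_assoc: "wedge (wedge \<alpha> \<beta>) \<eta> = wedge \<alpha> (wedge \<beta> \<eta>)"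
proof
  fix K :: "'a set"
  have "wedge (wedge \<alpha> \<beta>) \<eta> K = (\<Sum>(S, I)\<in>(SIGMA S:Pow K. Pow S).
      (-1) ^ (inversions S (K - S) + inversions I (S - I)) * \<alpha> I * \<beta> (S - I) * \<eta> (K - S))"
    unfolding wedge_def
    by (subst sum.Sigma[symmetric])
       (auto simp: sum_distrib_left sum_distrib_right power_add mult_ac intro!: sum.cong)
  also have "\<dots> = (\<Sum>(I, J)\<in>(SIGMA I:Pow K. Pow (K - I)).
      (-1) ^ (inversions I (K - I) + inversions J (K - I - J)) * \<alpha> I * \<beta> J * \<eta> (K - I - J))"
  proof (rule sum.reindex_bij_witness[of _ "\<lambda>(I, J). (I \<union> J, I)" "\<lambda>(S, I). (I, S - I)"],
      goal_cases)
    case (5 a)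
    then obtain S I where a: "a = (S, I)" "I \<subseteq> S" "S \<subseteq> K" by auto
    then have "K - I - (S - I) = K - S" by auto
    moreover have "inversions I (K - I) = inversions I (S - I) + inversions I (K - S)"
      using a by (subst inversions_Un_right[symmetric]) (auto intro!: arg_cong[of _ _ "inversions I"])
    moreover have "inversions S (K - S) = inversions I (K - S) + inversions (S - I) (K - S)"
      using a by (subst inversions_Un_left[symmetric])
        (auto intro!: arg_cong[of _ _ "\<lambda>X. inversions X (K - S)"])
    ultimately show ?case
      using a by (simp add: power_add mult_ac)
  qed auto
  also have "\<dots> = wedge \<alpha> (wedge \<beta> \<eta>) K"
    unfolding wedge_def
    by (subst sum.Sigma[symmetric])
       (auto simp: sum_distrib_left sum_distrib_right power_add mult_ac intro!: sum.cong)
  finally show "wedge (wedge \<alpha> \<beta>) \<eta> K = wedge \<alpha> (wedge \<beta> \<eta>) K" .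
qed

lemma wedge_dx_empty [simp]: "wedge (dx {}) \<alpha> = \<alpha>"
proof
  fix K
  have "wedge (dx {}) \<alpha> K = (\<Sum>I\<in>Pow K. if I = {} then \<alpha> K else 0)"
    unfolding wedge_def by (intro sum.cong) (auto simp: dx_def)
  then show "wedge (dx {}) \<alpha> K = \<alpha> K" by simp
qed

lemma wedge_list_Nil [simp]: "wedge_list [] = dx {}"
  and wedge_list_Cons [simp]: "wedge_list (\<alpha> # fs) = wedge \<alpha> (wedge_list fs)"
  by (simp_all add: wedge_list_def)

lemma wedge_list_append: "wedge_list (fs @ gs) = wedge (wedge_list fs) (wedge_list gs)"
  by (induction fs) (simp_all add: wedge_assoc)

lemma wedge_list_concat: "wedge_list (concat fss) = wedge_list (map wedge_list fss)"
  by (induction fss) (simp_all add: wedge_list_append)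

lemma wedge_scale_left: "wedge (\<lambda>K. c * \<alpha> K) \<beta> = (\<lambda>K. c * wedge \<alpha> \<beta> K)"
  and wedge_scale_right: "wedge \<alpha> (\<lambda>K. c * \<beta> K) = (\<lambda>K. c * wedge \<alpha> \<beta> K)"
  by (auto simp: wedge_def sum_distrib_left mult_ac intro!: ext sum.cong)

lemma wedge_sum_left: "wedge (\<lambda>K. \<Sum>i\<in>A. \<alpha> i K) \<beta> = (\<lambda>K. \<Sum>i\<in>A. wedge (\<alpha> i) \<beta> K)"
  unfolding wedge_def
  by (auto simp: sum_distrib_left sum_distrib_right intro!: ext sum.swap)

lemma wedge_sum_right: "wedge \<alpha> (\<lambda>K. \<Sum>i\<in>A. \<beta> i K) = (\<lambda>K. \<Sum>i\<in>A. wedge \<alpha> (\<beta> i) K)"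
  unfolding wedge_def
  by (auto simp: sum_distrib_left sum_distrib_right intro!: ext sum.swap)

lemma wedge_nonzeroE:
  assumes "wedge \<alpha> \<beta> K \<noteq> 0"
  obtains I where "I \<subseteq> K" "\<alpha> I \<noteq> 0" "\<beta> (K - I) \<noteq> 0"
proof -
  obtain I where "I \<in> Pow K" "(- 1) ^ inversions I (K - I) * \<alpha> I * \<beta> (K - I) \<noteq> 0"
    using assms unfolding wedge_def by (meson sum.neutral)
  then show thesis by (intro that[of I]) auto
qed

definition homogeneous :: "nat \<Rightarrow> 'c form \<Rightarrow> bool" where
  "homogeneous p \<alpha> \<longleftrightarrow> (\<forall>K. \<alpha> K \<noteq> 0 \<longrightarrow> card K = p)"

lemma homogeneous_wedge:
  fixes \<alpha> :: "'c::{finite,linorder} form"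
  assumes "homogeneous p \<alpha>" "homogeneous q \<beta>"
  shows "homogeneous (p + q) (wedge \<alpha> \<beta>)"
  unfolding homogeneous_def
proof (intro allI impI)
  fix K assume "wedge \<alpha> \<beta> K \<noteq> 0"
  then obtain I where "I \<subseteq> K" "\<alpha> I \<noteq> 0" "\<beta> (K - I) \<noteq> 0"
    by (rule wedge_nonzeroE)
  moreover from this have "card K = card I + card (K - I)"
    by (metis Diff_disjoint Diff_partition card_Un_disjoint finite)
  ultimately show "card K = p + q"
    using assms by (simp add: homogeneous_def)
qed

lemma wedge_graded_commute:
  fixes \<alpha> :: "'c::{finite,linorder} form"
  assumes "homogeneous p \<alpha>" "homogeneous q \<beta>"
  shows "wedge \<beta> \<alpha> = (\<lambda>K. (-1) ^ (p * q) * wedge \<alpha> \<beta> K)"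
proof
  fix K
  have "wedge \<beta> \<alpha> K = (\<Sum>I\<in>Pow K. (-1) ^ inversions (K - I) I * \<beta> (K - I) * \<alpha> I)"
    unfolding wedge_def
    by (rule sum.reindex_bij_witness[of _ "\<lambda>I. K - I" "\<lambda>I. K - I"]) (auto simp: double_diff)
  also have "\<dots> = (\<Sum>I\<in>Pow K. (-1) ^ (p * q) * ((-1) ^ inversions I (K - I) * \<alpha> I * \<beta> (K - I)))"
  proof (intro sum.cong refl)
    fix I assume "I \<in> Pow K"
    show "(-1) ^ inversions (K - I) I * \<beta> (K - I) * \<alpha> I =
        (-1) ^ (p * q) * ((-1) ^ inversions I (K - I) * \<alpha> I * \<beta> (K - I))"
    proof (cases "\<alpha> I = 0 \<or> \<beta> (K - I) = 0")
      case False
      then have "inversions I (K - I) + inversions (K - I) I = p * q"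
        using assms inversions_swap[of I "K - I"] by (auto simp: homogeneous_def)
      then have "(-1::real) ^ (p * q) * (-1) ^ inversions I (K - I) =
          (-1) ^ (2 * inversions I (K - I) + inversions (K - I) I)"
        by (metis add.commute add.left_commute mult_2 power_add)
      also have "\<dots> = (-1) ^ inversions (K - I) I"
        by (simp add: power_add power_mult)
      finally show ?thesis by (simp add: mult_ac)
    qed auto
  qed
  finally show "wedge \<beta> \<alpha> K = (-1) ^ (p * q) * wedge \<alpha> \<beta> K"
    by (simp add: wedge_def sum_distrib_left)
qed

definition covector :: "('c \<Rightarrow> real) \<Rightarrow> 'c::finite form" where
  "covector v = (\<lambda>K. \<Sum>c\<in>UNIV. v c * dx {c} K)"

lemma homogeneous_dx: "homogeneous (card I) (dx I)"
  by (auto simp: homogeneous_def dx_def)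

lemma homogeneous_wedge_list:
  assumes "\<And>\<alpha>. \<alpha> \<in> set fs \<Longrightarrow> homogeneous p \<alpha>"
  shows "homogeneous (p * length fs) (wedge_list fs)"
  using assms
proof (induction fs)
  case Nil
  then show ?case using homogeneous_dx[of "{}"] by simp
next
  case (Cons \<alpha> fs)
  then show ?case
    using homogeneous_wedge[of p \<alpha> "p * length fs" "wedge_list fs"] by simp
qed

text \<open>Moving \<open>\<beta>\<close> to the left across the forms in between and then \<open>\<alpha>\<close> to its place costs the same
  sign twice; the only sign left is that of exchanging \<open>\<alpha>\<close> with \<open>\<beta>\<close>.\<close>

lemma wedge_list_swap:
  fixes \<alpha> \<beta> :: "'c::{finite,linorder} form"
  assumes "homogeneous 1 \<alpha>" "homogeneous 1 \<beta>" "\<And>\<eta>. \<eta> \<in> set gs \<Longrightarrow> homogeneous 1 \<eta>"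
  shows "wedge_list (fs @ \<alpha> # gs @ \<beta> # hs) = (\<lambda>K. - wedge_list (fs @ \<beta> # gs @ \<alpha> # hs) K)"
proof -
  define q where "q = length gs"
  have gs: "homogeneous q (wedge_list gs)"
    using homogeneous_wedge_list[of gs 1] assms(3) by (simp add: q_def)
  have move: "wedge (wedge_list gs) (wedge \<xi> X) = (\<lambda>K. (-1) ^ q * wedge \<xi> (wedge (wedge_list gs) X) K)"
    if "homogeneous 1 \<xi>" for \<xi> X
    using wedge_graded_commute[OF that gs]
    by (simp add: wedge_assoc[symmetric] wedge_scale_left)
  have exchange: "wedge \<alpha> (wedge \<beta> X) = (\<lambda>K. - wedge \<beta> (wedge \<alpha> X) K)" for X
  proof -
    have "wedge \<alpha> \<beta> = (\<lambda>K. (-1) * wedge \<beta> \<alpha> K)"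
      using wedge_graded_commute[OF assms(2,1)] by simp
    then have "wedge (wedge \<alpha> \<beta>) X = (\<lambda>K. (-1) * wedge (wedge \<beta> \<alpha>) X K)"
      by (metis wedge_scale_left)
    then show ?thesis by (simp add: wedge_assoc)
  qed
  have neg: "wedge \<xi> (\<lambda>K. - \<eta> K) = (\<lambda>K. - wedge \<xi> \<eta> K)" for \<xi> \<eta> :: "'c form"
    using wedge_scale_right[of \<xi> "-1" \<eta>] by simp
  show ?thesis
    by (simp add: wedge_list_append move[OF assms(1)] move[OF assms(2)] wedge_scale_right exchange neg)
qed

section \<open>Wedge products of covectors are determinants\<close>

lemma pos_less_card: "pos (a::'a::{finite,linorder}) < CARD('a)"
  unfolding pos_def by (rule psubset_card_mono) auto

lemma nth_index_mono:
  fixes K :: "'a::{finite,linorder} set"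
  assumes "p < q" "q < card K"
  shows "nth_index K p < nth_index K q"
  unfolding nth_index_def
  using assms strict_sorted_list_of_set[of K]
  by (auto simp: sorted_wrt_iff_nth_less simp del: strict_sorted_list_of_set)

lemma bij_betw_nth_index:
  fixes K :: "'a::{finite,linorder} set"
  shows "bij_betw (nth_index K) {..<card K} K"
  using bij_betw_nth[of "sorted_list_of_set K" "{..<card K}" K]
  by (simp add: nth_index_def[abs_def])

lemma pos_nth_index [simp]:
  assumes "p < CARD('a)"
  shows "pos (nth_index (UNIV::'a::{finite,linorder} set) p) = p"
proof -
  let ?f = "nth_index (UNIV::'a set)"
  have bij: "bij_betw ?f {..<CARD('a)} UNIV" by (rule bij_betw_nth_index)
  have "{i. i < ?f p} = ?f ` {..<p}"
  proof (intro equalityI subsetI)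
    fix i assume i: "i \<in> {i. i < ?f p}"
    obtain q where q: "q < CARD('a)" "i = ?f q"
      using bij by (metis UNIV_I bij_betw_iff_bijections lessThan_iff)
    with i have "q < p"
      using nth_index_mono[of p q UNIV] assms by (metis less_asym linorder_neqE_nat mem_Collect_eq)
    then show "i \<in> ?f ` {..<p}" using q by auto
  qed (use nth_index_mono[of _ p UNIV] assms in auto)
  moreover have "inj_on ?f {..<p}"
    using bij assms by (auto simp: bij_betw_def intro: inj_on_subset)
  ultimately show ?thesis by (simp add: pos_def card_image)
qed

lemma nth_index_pos [simp]: "nth_index UNIV (pos a) = (a::'a::{finite,linorder})"
proof -
  obtain q where "q < CARD('a)" "a = nth_index UNIV q"
    using bij_betw_nth_index[of "UNIV::'a set"] by (metis UNIV_I bij_betw_iff_bijections lessThan_iff)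
  then show ?thesis by simp
qed

lemma pos_inject [simp]: "pos a = pos b \<longleftrightarrow> a = (b::'a::{finite,linorder})"
  by (metis nth_index_pos)

lemma pos_mono: "a < b \<Longrightarrow> pos a < pos (b::'a::{finite,linorder})"
  unfolding pos_def by (rule psubset_card_mono) auto

lemma pos_less_iff [simp]: "pos a < pos b \<longleftrightarrow> a < (b::'a::{finite,linorder})"
  by (metis less_asym pos_mono linorder_neqE pos_inject)

lemma bij_betw_pos: "bij_betw pos (UNIV::'a::{finite,linorder} set) {..<CARD('a)}"
  by (rule bij_betw_byWitness[where f' = "nth_index UNIV"]) (auto simp: pos_less_card)

lemma wedge_list_covector_expand:
  "wedge_list (map covector vs) K =
     (\<Sum>q | length q = length vs. (\<Prod>a<length vs. (vs ! a) (q ! a)) * wedge_list (map (\<lambda>c. dx {c}) q) K)"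
proof (induction vs arbitrary: K)
  case (Cons v vs)
  have *: "{q. length q = Suc (length vs)} = (\<lambda>(c, q). c # q) ` (UNIV \<times> {q. length q = length vs})"
    by (auto simp: length_Suc_conv image_iff)
  have IH: "wedge_list (map covector vs) = (\<lambda>K. \<Sum>q | length q = length vs.
      (\<Prod>a<length vs. (vs ! a) (q ! a)) * wedge_list (map (\<lambda>c. dx {c}) q) K)"
    by (intro ext Cons.IH)
  have "wedge_list (map covector (v # vs)) K =
      wedge (covector v) (\<lambda>K. \<Sum>q | length q = length vs.
        (\<Prod>a<length vs. (vs ! a) (q ! a)) * wedge_list (map (\<lambda>c. dx {c}) q) K) K"
    unfolding IH[symmetric] by simp
  also have "\<dots> = (\<Sum>c\<in>UNIV. \<Sum>q | length q = length vs.
      v c * ((\<Prod>a<length vs. (vs ! a) (q ! a)) * wedge_list (map (\<lambda>c. dx {c}) (c # q)) K))"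
    unfolding covector_def
    by (simp add: wedge_sum_left wedge_sum_right wedge_scale_left wedge_scale_right sum_distrib_left
      del: wedge_list_def)
  also have "\<dots> = (\<Sum>(c, q)\<in>UNIV \<times> {q. length q = length vs}.
      v c * ((\<Prod>a<length vs. (vs ! a) (q ! a)) * wedge_list (map (\<lambda>c. dx {c}) (c # q)) K))"
    by (rule sum.cartesian_product)
  also have "\<dots> = (\<Sum>q | length q = Suc (length vs).
      (\<Prod>a<Suc (length vs). ((v # vs) ! a) (q ! a)) * wedge_list (map (\<lambda>c. dx {c}) q) K)"
    unfolding * by (subst sum.reindex)
      (auto simp: inj_on_def prod.lessThan_Suc_shift case_prod_beta mult_ac intro!: sum.cong
        simp del: prod.lessThan_Suc)
  finally show ?case by simp
qed simp

lemma wedge_list_dx_nonzeroD: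
  assumes "wedge_list (map (\<lambda>c. dx {c}) q) K \<noteq> 0"
  shows "distinct q \<and> set q = K"
  using assms
proof (induction q arbitrary: K)
  case (Cons c q)
  then obtain I where "I \<subseteq> K" "dx {c} I \<noteq> (0::real)" "wedge_list (map (\<lambda>c. dx {c}) q) (K - I) \<noteq> 0"
    by (auto elim: wedge_nonzeroE)
  with Cons.IH show ?case by (auto simp: dx_def split: if_splits)
qed (auto simp: dx_def split: if_splits)

lemma wedge_list_dx_sorted:
  assumes "sorted_wrt (<) q"
  shows "wedge_list (map (\<lambda>c. dx {c}) q) = dx (set q)"
  using assms
proof (induction q)
  case (Cons c q)
  then have "{c} \<inter> set q = {}" by auto
  moreover have "inversions {c} (set q) = 0"
    using Cons.prems by (intro inversions_ordered) auto
  ultimately show ?case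
    using Cons by (simp add: wedge_dx_disjoint)
qed simp

lemma sorted_list_of_set_eq_map_nth_index:
  "sorted_list_of_set (K::'a::{finite,linorder} set) = map (nth_index K) [0..<card K]"
  by (rule nth_equalityI) (auto simp: nth_index_def)

lemma wedge_list_dx_transpose:
  fixes g :: "nat \<Rightarrow> 'c::{finite,linorder}"
  assumes "i < N" "j < N" "i \<noteq> j"
  shows "wedge_list (map (\<lambda>n. dx {g (Transposition.transpose i j n)}) [0..<N]) K =
     - wedge_list (map (\<lambda>n. dx {g n}) [0..<N]) K"
proof -
  have *: "wedge_list (map (\<lambda>n. dx {g (Transposition.transpose i j n)}) [0..<N]) K =
     - wedge_list (map (\<lambda>n. dx {g n}) [0..<N]) K" if "i < j" "j < N" for i j
  proof -
    have split: "[0..<N] = [0..<i] @ i # [Suc i..<j] @ j # [Suc j..<N]"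
      using that upt_add_eq_append[of 0 i "N - i"] upt_conv_Cons[of i N]
        upt_add_eq_append[of "Suc i" j "N - j"] upt_conv_Cons[of j N]
      by (metis less_eq_Suc_le less_imp_add_positive less_imp_le_nat less_trans
          upt_add_eq_append zero_le)
    have outside: "map (\<lambda>n. dx {g (Transposition.transpose i j n)}) xs = (map (\<lambda>n. dx {g n}) xs :: 'c form list)"
      if "\<forall>n\<in>set xs. n \<noteq> i \<and> n \<noteq> j" for xs
      using that by (auto simp: Transposition.transpose_def)
    have eqs: "map (\<lambda>n. dx {g (Transposition.transpose i j n)}) [0..<i] = (map (\<lambda>n. dx {g n}) [0..<i] :: 'c form list)"
      "map (\<lambda>n. dx {g (Transposition.transpose i j n)}) [Suc i..<j] = (map (\<lambda>n. dx {g n}) [Suc i..<j] :: 'c form list)"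
      "map (\<lambda>n. dx {g (Transposition.transpose i j n)}) [Suc j..<N] = (map (\<lambda>n. dx {g n}) [Suc j..<N] :: 'c form list)"
      using that by (auto intro!: outside)
    have one: "homogeneous 1 (dx {c})" for c :: 'c
      using homogeneous_dx[of "{c}"] by simp
    have "map (\<lambda>n. dx {g (Transposition.transpose i j n)}) [0..<N] =
        map (\<lambda>n. dx {g n}) [0..<i] @ dx {g j} # map (\<lambda>n. dx {g n}) [Suc i..<j] @ dx {g i} #
          (map (\<lambda>n. dx {g n}) [Suc j..<N] :: 'c form list)"
      unfolding split map_append list.map eqs by simp
    moreover have "map (\<lambda>n. dx {g n}) [0..<N] =
        map (\<lambda>n. dx {g n}) [0..<i] @ dx {g i} # map (\<lambda>n. dx {g n}) [Suc i..<j] @ dx {g j} #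
          (map (\<lambda>n. dx {g n}) [Suc j..<N] :: 'c form list)"
      unfolding split map_append list.map ..
    ultimately show ?thesis
      using one by (simp only:) (subst wedge_list_swap; auto)
  qed
  show ?thesis
    using *[of i j] *[of j i] assms by (metis linorder_neqE_nat Transposition.transpose_commute)
qed

text \<open>Expanding each factor in the basis \<open>dx {c}\<close> leaves the products of distinct basis covectors;
  these correspond to permutations, and each transposition contributes a factor \<open>-1\<close>.  So the sum is
  the Leibniz formula for the minor with column set \<open>K\<close>.\<close>

lemma det_eq_wedge_list_covector:
  fixes v :: "nat \<Rightarrow> 'c::{finite,linorder} \<Rightarrow> real" and K :: "'c set"
  assumes K: "card K = CARD('d::{finite,linorder})"
  shows "det (\<chi> (a::'d) (b::'d). v (pos a) (nth_index K (pos b))) =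
    wedge_list (map (\<lambda>a. covector (v a)) [0..<CARD('d)]) K"
proof -
  define N where "N = CARD('d)"
  define e where "e = nth_index (UNIV::'d set)"
  define h where "h = nth_index K"
  define word where "word p = map (\<lambda>n. h (pos (p (e n)))) [0..<N]" for p :: "'d \<Rightarrow> 'd"
  define s where "s q = wedge_list (map (\<lambda>c. dx {c}) q) K" for q :: "'c list"
  have bij_h: "bij_betw h {..<N} K"
    using bij_betw_nth_index[of K] K by (simp add: h_def N_def)
  have e_pos: "e (pos a) = a" for a by (simp add: e_def)
  have pos_e: "pos (e n) = n" if "n < N" for n using that by (simp add: e_def N_def)
  have pos_N: "pos (a::'d) < N" for a by (simp add: N_def pos_less_card)
  have sign: "s (word p) = of_int (sign p)" if "p permutes UNIV" for p
    using that finite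
  proof (induction rule: permutes_induct)
    case id
    have "word id = sorted_list_of_set K"
      using K pos_e by (auto simp: word_def sorted_list_of_set_eq_map_nth_index h_def N_def)
    then show ?case
      using wedge_list_dx_sorted[of "sorted_list_of_set K"] strict_sorted_list_of_set[of K]
        sign_id by (simp only: s_def) (simp add: dx_def)
  next
    case (swap a b p)
    define i where "i = pos (inv p a)"
    define j where "j = pos (inv p b)"
    have p: "bij p" using swap by (simp add: permutes_bij)
    have ij: "i < N" "j < N" "i \<noteq> j"
      using swap(3) p by (auto simp: i_def j_def pos_N bij_is_surj dest: arg_cong[of _ _ p] surj_f_inv_f)
        (metis bij_inv_eq_iff)
    have "Transposition.transpose a b (p (e n)) = p (e (Transposition.transpose i j n))" if "n < N" for n
    proof -
      have "p (e n) = a \<longleftrightarrow> n = i" "p (e n) = b \<longleftrightarrow> n = j"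
        using p that unfolding i_def j_def by (metis bij_inv_eq_iff e_pos pos_e)+
      moreover have "p (e i) = a" "p (e j) = b"
        using p by (simp_all add: i_def j_def e_pos bij_is_surj surj_f_inv_f)
      ultimately show ?thesis by (auto simp: Transposition.transpose_def)
    qed
    then have "word (Transposition.transpose a b \<circ> p) = map (\<lambda>n. h (pos (p (e (Transposition.transpose i j n))))) [0..<N]"
      by (auto simp: word_def)
    then have "s (word (Transposition.transpose a b \<circ> p)) =
        wedge_list (map (\<lambda>n. dx {h (pos (p (e (Transposition.transpose i j n))))}) [0..<N]) K"
      by (simp add: s_def o_def)
    also have "\<dots> = - s (word p)"
      using wedge_list_dx_transpose[OF ij, of "\<lambda>n. h (pos (p (e n)))" K] by (simp add: s_def word_def o_def)
    also have "\<dots> = of_int (sign (Transposition.transpose a b \<circ> p))"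
      using swap by (subst sign_compose)
        (auto simp: permutation_swap_id sign_swap_id intro: permutes_imp_permutation[of UNIV])
    finally show ?case .
  qed
  have bij_word: "bij_betw word {p. p permutes UNIV} {q. distinct q \<and> set q = K \<and> length q = N}"
  proof (rule bij_betw_byWitness[where f' = "\<lambda>q a. e (inv_into {..<N} h (q ! pos a))"])
    show "\<forall>p\<in>{p. p permutes UNIV}. (\<lambda>a. e (inv_into {..<N} h (word p ! pos a))) = p"
      using bij_betw_imp_inj_on[OF bij_h]
      by (auto simp: word_def pos_N e_pos inv_into_f_f)
    have h_inv: "h (inv_into {..<N} h c) = c" "inv_into {..<N} h c < N" if "c \<in> K" for c
      using bij_h that by (auto simp: bij_betw_def f_inv_into_f)
    show "\<forall>q\<in>{q. distinct q \<and> set q = K \<and> length q = N}.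
        word (\<lambda>a. e (inv_into {..<N} h (q ! pos a))) = q"
    proof (intro ballI nth_equalityI)
      fix q n assume q: "q \<in> {q. distinct q \<and> set q = K \<and> length q = N}"
      show "length (word (\<lambda>a. e (inv_into {..<N} h (q ! pos a)))) = length q"
        using q by (simp add: word_def)
      assume "n < length (word (\<lambda>a. e (inv_into {..<N} h (q ! pos a))))"
      then have n: "n < N" by (simp add: word_def)
      with q have "q ! n \<in> K" by auto
      then show "word (\<lambda>a. e (inv_into {..<N} h (q ! pos a))) ! n = q ! n"
        using n by (simp add: word_def pos_e h_inv)
    qed
    show "word ` {p. p permutes UNIV} \<subseteq> {q. distinct q \<and> set q = K \<and> length q = N}"
    proof safe
      fix p :: "'d \<Rightarrow> 'd" assume p: "p permutes UNIV"
      then have "s (word p) \<noteq> 0" by (simp add: sign sign_nz)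
      then have "distinct (word p) \<and> set (word p) = K"
        unfolding s_def by (rule wedge_list_dx_nonzeroD)
      then show "distinct (word p)" "\<And>x. x \<in> set (word p) \<Longrightarrow> x \<in> K" "\<And>x. x \<in> K \<Longrightarrow> x \<in> set (word p)"
        by auto
      show "length (word p) = N" by (simp add: word_def)
    qed
    show "(\<lambda>q a. e (inv_into {..<N} h (q ! pos a))) ` {q. distinct q \<and> set q = K \<and> length q = N}
        \<subseteq> {p. p permutes UNIV}"
    proof safe
      fix q assume q: "distinct q" "K = set q" "N = length q"
      have "inj (\<lambda>a::'d. e (inv_into {..<N} h (q ! pos a)))"
      proof (rule injI)
        fix a b :: 'd assume *: "e (inv_into {..<N} h (q ! pos a)) = e (inv_into {..<N} h (q ! pos b))"
        have "q ! pos c \<in> K" for c :: 'd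
          using q nth_mem[of "pos c" q] pos_N[of c] by simp
        then have m: "q ! pos a \<in> K" "q ! pos b \<in> K" by auto
        from * have "inv_into {..<N} h (q ! pos a) = inv_into {..<N} h (q ! pos b)"
          using h_inv m pos_e by metis
        then have "q ! pos a = q ! pos b" using h_inv m by metis
        then show "a = b"
          using q pos_N by (metis nth_eq_iff_index_eq pos_inject)
      qed
      then show "(\<lambda>a. e (inv_into {..<length q} h (q ! pos a))) permutes UNIV"
        unfolding q(3) by (intro bij_imp_permutes) (simp_all add: bij_betw_def finite_UNIV_inj_surj)
    qed
  qed
  have "wedge_list (map (\<lambda>a. covector (v a)) [0..<N]) K =
      wedge_list (map covector (map v [0..<N])) K"
    by (simp add: o_def)
  also have "\<dots> = (\<Sum>q | length q = N. (\<Prod>a<N. v a (q ! a)) * s q)"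
    by (subst wedge_list_covector_expand) (auto simp: s_def intro!: sum.cong prod.cong)
  also have "\<dots> = (\<Sum>q | distinct q \<and> set q = K \<and> length q = N. (\<Prod>a<N. v a (q ! a)) * s q)"
    by (rule sum.mono_neutral_right)
       (use wedge_list_dx_nonzeroD finite_lists_length_eq[of "UNIV::'c set" N] in \<open>auto simp: s_def\<close>)
  also have "\<dots> = (\<Sum>p | p permutes UNIV. (\<Prod>a<N. v a (word p ! a)) * s (word p))"
    by (rule sum.reindex_bij_betw[OF bij_word, symmetric])
  also have "\<dots> = (\<Sum>p | p permutes (UNIV::'d set). of_int (sign p) * (\<Prod>a\<in>UNIV. v (pos a) (h (pos (p a)))))"
  proof (intro sum.cong refl)
    fix p :: "'d \<Rightarrow> 'd" assume "p \<in> {p. p permutes UNIV}"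
    moreover have "(\<Prod>a\<in>UNIV. v (pos a) (h (pos (p a)))) = (\<Prod>a\<in>UNIV. v (pos a) (word p ! pos (a::'d)))"
      by (intro prod.cong refl) (simp add: word_def pos_N e_pos)
    moreover have "\<dots> = (\<Prod>a<N. v a (word p ! a))"
      using prod.reindex_bij_betw[OF bij_betw_pos[where 'a = 'd], of "\<lambda>a. v a (word p ! a)"] by (simp add: N_def)
    ultimately show "(\<Prod>a<N. v a (word p ! a)) * s (word p) =
        of_int (sign p) * (\<Prod>a\<in>UNIV. v (pos a) (h (pos (p a))))"
      by (simp add: sign)
  qed
  finally show ?thesis
    by (simp add: det_def N_def h_def)
qed

section \<open>The Jacobian determinant of the configuration map\<close>

lemma homogeneous_covector: "homogeneous 1 (covector v)"
proof -
  have "covector v K = 0" if "card K \<noteq> 1" for K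
    unfolding covector_def using that by (intro sum.neutral) (auto simp: dx_def)
  then show ?thesis by (auto simp: homogeneous_def)
qed

lemma wedge_list_eq_0_if_meets:
  fixes fs :: "'c::{finite,linorder} form list"
  assumes "\<And>\<alpha> L. \<alpha> \<in> set fs \<Longrightarrow> L \<inter> T \<noteq> {} \<Longrightarrow> \<alpha> L = 0" "K \<inter> T \<noteq> {}"
  shows "wedge_list fs K = 0"
  using assms
proof (induction fs arbitrary: K)
  case Nil
  then show ?case by (auto simp: dx_def)
next
  case (Cons \<alpha> fs)
  show ?case
  proof (rule ccontr)
    assume "wedge_list (\<alpha> # fs) K \<noteq> 0"
    then obtain I where I: "I \<subseteq> K" "\<alpha> I \<noteq> 0" "wedge_list fs (K - I) \<noteq> 0"
      by (auto elim: wedge_nonzeroE)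
    have "I \<inter> T = {}" using Cons.prems(1)[of \<alpha> I] I(2) by auto
    moreover have "(K - I) \<inter> T = {}" using Cons.IH[of "K - I"] Cons.prems(1) I(3) by auto
    ultimately show False using Cons.prems(2) by blast
  qed
qed

lemma upt_mult_eq_concat: "[0..<k * m] = concat (map (\<lambda>j. map (\<lambda>a. j * m + a) [0..<m]) [0..<k])"
proof (induction k)
  case (Suc k)
  have "[0..<Suc k * m] = [0..<k * m] @ map (\<lambda>a. k * m + a) [0..<m]"
    using upt_add_eq_append[of 0 "k * m" m] map_add_upt[of "k * m" m] by (simp add: add.commute)
  then show ?case using Suc by simp
qed simp

lemma nth_index_Un:
  fixes I J :: "'c::{finite,linorder} set"
  assumes "\<And>i j. i \<in> I \<Longrightarrow> j \<in> J \<Longrightarrow> i < j" "p < card I + card J"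
  shows "nth_index (I \<union> J) p = (if p < card I then nth_index I p else nth_index J (p - card I))"
proof -
  have "sorted_list_of_set (I \<union> J) = sorted_list_of_set I @ sorted_list_of_set J"
  proof (rule strict_sorted_equal)
    show "sorted_wrt (<) (sorted_list_of_set I @ sorted_list_of_set J)"
      unfolding sorted_wrt_append using assms(1) by (auto simp del: strict_sorted_iff)
  qed (auto simp del: strict_sorted_iff)
  then show ?thesis by (auto simp: nth_index_def nth_append)
qed

lemma nth_index_image:
  fixes f :: "'c::{finite,linorder} \<Rightarrow> 'd::{finite,linorder}"
  assumes "strict_mono f" "p < card I"
  shows "nth_index (f ` I) p = f (nth_index I p)"
proof -
  have "sorted_list_of_set (f ` I) = map f (sorted_list_of_set I)"
  proof (rule strict_sorted_equal)
    show "sorted_wrt (<) (map f (sorted_list_of_set I))"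
      unfolding sorted_wrt_map using strict_mono_less[OF assms(1)] by (simp del: strict_sorted_iff)
  qed (auto simp del: strict_sorted_iff)
  then show ?thesis using assms(2) by (simp add: nth_index_def)
qed

abbreviation slot :: "nat \<Rightarrow> 'i::{finite,linorder}" where
  "slot p \<equiv> nth_index UNIV p"

text \<open>The shape of the Jacobian matrix of \<open>(x, t\<^sub>0, \<dots>, t\<^sub>k\<^sub>-\<^sub>1) \<mapsto> (\<gamma>(t\<^sub>0, x), \<dots>, \<gamma>(t\<^sub>k\<^sub>-\<^sub>1, x))\<close>:
  the columns of \<open>x\<close> come first, those of \<open>t\<^sub>0\<close>, \<open>t\<^sub>1\<close>, \<dots> follow, and the columns of \<open>t\<^sub>j\<close> vanish
  outside the \<open>j\<close>-th block of rows.  This order of the columns agrees with the one in the minors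
  that define \<open>\<omega>\<close>.\<close>

locale block_jacobian =
  fixes k :: nat
    and A :: "((real, 'i::{finite,linorder}) vec, 'i) vec"
    and P :: "nat \<Rightarrow> 'b::{finite,linorder} \<Rightarrow> 'm::{finite,linorder} rvec"
    and Q :: "nat \<Rightarrow> 'n::{finite,linorder} \<Rightarrow> 'm rvec"
  assumes card_less: "CARD('n) < CARD('m)"
    and card_b: "CARD('b) = (CARD('m) - CARD('n)) * k"
    and card_i: "CARD('i) = k * CARD('m)"
    and x_entry: "\<And>j a i. j < k \<Longrightarrow> A $ slot (j * CARD('m) + pos a) $ slot (pos i) = P j i $ a"
    and t_entry: "\<And>j a j' l. j < k \<Longrightarrow> j' < k \<Longrightarrow>
      A $ slot (j * CARD('m) + pos a) $ slot (CARD('b) + (j' * CARD('n) + pos l)) = (if j' = j then Q j l $ a else 0)"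
begin

definition r :: nat where "r = CARD('m) - CARD('n)"

definition row_form :: "nat \<Rightarrow> 'i form" where
  "row_form a = covector (\<lambda>c. A $ slot a $ c)"

definition block_form :: "nat \<Rightarrow> 'i form" where
  "block_form j = wedge_list (map (\<lambda>a. row_form (j * CARD('m) + a)) [0..<CARD('m)])"

definition minor_form :: "nat \<Rightarrow> 'b form" where
  "minor_form j = (\<lambda>I. if card I = r then
      det (\<chi> (a::'m) (b::'m). (if pos b < r then P j (nth_index I (pos b)) else Q j (slot (pos b - r))) $ a)
    else 0)"

definition x_slot :: "'b \<Rightarrow> 'i" where "x_slot i = slot (pos i)"

definition t_slots :: "nat \<Rightarrow> 'i set" where
  "t_slots j = (\<lambda>p. slot (CARD('b) + (j * CARD('n) + p))) ` {..<CARD('n)}"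

lemma card_b_plus: "CARD('b) + k * CARD('n) = CARD('i)"
  using card_less unfolding card_b card_i
  by (simp add: diff_mult_distrib mult.commute add_mult_distrib[symmetric] flip: add_mult_distrib2)

lemma t_index_less: "j < k \<Longrightarrow> p < CARD('n) \<Longrightarrow> CARD('b) + (j * CARD('n) + p) < CARD('i)"
proof -
  assume "j < k" "p < CARD('n)"
  then have "j * CARD('n) + p < (j + 1) * CARD('n)" "(j + 1) * CARD('n) \<le> k * CARD('n)"
    by (simp, intro mult_right_mono) auto
  then show ?thesis using card_b_plus by linarith
qed

lemma x_index_less: "pos (i::'b) < CARD('i)"
  using pos_less_card[of i] card_b_plus by linarith

lemma pos_x_slot: "pos (x_slot i) = pos i"
  by (simp add: x_slot_def x_index_less)

lemma strict_mono_x_slot: "strict_mono x_slot"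
  by (rule strict_monoI, subst pos_less_iff[symmetric]) (simp add: pos_x_slot)

lemma in_t_slots_iff: "j < k \<Longrightarrow> c \<in> t_slots j \<longleftrightarrow>
    CARD('b) + j * CARD('n) \<le> pos c \<and> pos c < CARD('b) + (j + 1) * CARD('n)"
proof
  assume "j < k" "c \<in> t_slots j"
  then show "CARD('b) + j * CARD('n) \<le> pos c \<and> pos c < CARD('b) + (j + 1) * CARD('n)"
    by (auto simp: t_slots_def t_index_less)
next
  assume "j < k" and *: "CARD('b) + j * CARD('n) \<le> pos c \<and> pos c < CARD('b) + (j + 1) * CARD('n)"
  then have "c = slot (CARD('b) + (j * CARD('n) + (pos c - CARD('b) - j * CARD('n))))"
    by simp
  moreover have "pos c - CARD('b) - j * CARD('n) < CARD('n)" using * unfolding add_mult_distrib by linarith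
  ultimately show "c \<in> t_slots j" unfolding t_slots_def by blast
qed

lemma card_t_slots: "j < k \<Longrightarrow> card (t_slots j) = CARD('n)"
proof -
  assume j: "j < k"
  have "inj_on (\<lambda>p. slot (CARD('b) + (j * CARD('n) + p)) :: 'i) {..<CARD('n)}"
    by (rule inj_on_inverseI[where g = "\<lambda>c. pos c - CARD('b) - j * CARD('n)"]) (simp add: t_index_less[OF j])
  then show ?thesis by (simp add: t_slots_def card_image)
qed

lemma x_slot_less_t_slots: "j < k \<Longrightarrow> c \<in> t_slots j \<Longrightarrow> x_slot i < c"
  using pos_less_card[of i] by (subst pos_less_iff[symmetric]) (simp add: pos_x_slot in_t_slots_iff)

lemma t_slots_less:
  assumes "j < j'" "j' < k" "c \<in> t_slots j" "c' \<in> t_slots j'"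
  shows "c < c'"
proof -
  have "(j + 1) * CARD('n) \<le> j' * CARD('n)"
    using assms by (intro mult_right_mono) auto
  then have "pos c < pos c'"
    using assms in_t_slots_iff[of j c] in_t_slots_iff[of j' c'] by linarith
  then show ?thesis by simp
qed

lemma x_slot_t_slots_disjoint: "j < k \<Longrightarrow> x_slot ` I \<inter> t_slots j = {}"
  using x_slot_less_t_slots by blast

lemma slots_cover: "range x_slot \<union> (\<Union>j<k. t_slots j) = UNIV"
proof (intro equalityI subsetI UNIV_I)
  fix c :: 'i
  show "c \<in> range x_slot \<union> (\<Union>j<k. t_slots j)"
  proof (cases "pos c < CARD('b)")
    case True
    then have "c = x_slot (slot (pos c))" by (simp add: x_slot_def)
    then show ?thesis by blast
  next
    case False
    define j where "j = (pos c - CARD('b)) div CARD('n)"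
    have "pos c - CARD('b) < k * CARD('n)" using pos_less_card[of c] card_b_plus False by linarith
    then have "j < k" by (simp add: j_def less_mult_imp_div_less)
    moreover have "j * CARD('n) \<le> pos c - CARD('b)" "pos c - CARD('b) < (j + 1) * CARD('n)"
      unfolding j_def using div_mult_mod_eq[of "pos c - CARD('b)" "CARD('n)"] mod_less_divisor[of "CARD('n)"]
      by (linarith, simp add: dividend_less_div_times)
    ultimately show ?thesis using False in_t_slots_iff[of j c] by fastforce
  qed
qed

lemma homogeneous_block_form: "homogeneous CARD('m) (block_form j)"
  using homogeneous_wedge_list[of "map (\<lambda>a. row_form (j * CARD('m) + a)) [0..<CARD('m)]" 1]
    homogeneous_covector by (auto simp: block_form_def row_form_def)

lemma block_form_eq_det:
  assumes "card K = CARD('m)"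
  shows "block_form j K = det (\<chi> (a::'m) (b::'m). A $ slot (j * CARD('m) + pos a) $ nth_index K (pos b))"
  unfolding block_form_def row_form_def
  using det_eq_wedge_list_covector[OF assms, of "\<lambda>a c. A $ slot (j * CARD('m) + a) $ c"] by simp

lemma block_form_eq_0_if_meets:
  assumes "j < k" "j' < k" "j' \<noteq> j" "K \<inter> t_slots j' \<noteq> {}"
  shows "block_form j K = 0"
proof (cases "card K = CARD('m)")
  case True
  obtain c where c: "c \<in> K" "c \<in> t_slots j'" using assms(4) by blast
  then obtain p where p: "p < CARD('n)" "c = slot (CARD('b) + (j' * CARD('n) + p))"
    by (auto simp: t_slots_def)
  obtain q where q: "q < CARD('m)" "nth_index K q = c"
    using bij_betw_nth_index[of K] c(1) True by (metis bij_betw_iff_bijections lessThan_iff)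
  have "A $ slot (j * CARD('m) + pos a) $ c = 0" for a :: 'm
    using t_entry[OF assms(1,2), of a "slot p"] p assms(3) by simp
  then have "column (slot q) (\<chi> (a::'m) (b::'m). A $ slot (j * CARD('m) + pos a) $ nth_index K (pos b)) = 0"
    using q by (simp add: column_def vec_eq_iff)
  then show ?thesis
    unfolding block_form_eq_det[OF True] by (rule det_zero_column)
next
  case False
  then show ?thesis using homogeneous_block_form by (auto simp: homogeneous_def)
qed

lemma card_x_t_slots: "j < k \<Longrightarrow> card (x_slot ` I \<union> t_slots j) = card I + CARD('n)"
  using x_slot_t_slots_disjoint[of j I] strict_mono_imp_inj_on[OF strict_mono_x_slot, of I]
  by (simp add: card_Un_disjoint card_image card_t_slots)

lemma nth_index_t_slots:
  assumes "j < k" "p < CARD('n)"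
  shows "nth_index (t_slots j) p = slot (CARD('b) + (j * CARD('n) + p))"
proof -
  let ?f = "\<lambda>p. slot (CARD('b) + (j * CARD('n) + p)) :: 'i"
  have "sorted_list_of_set (t_slots j) = map ?f [0..<CARD('n)]"
  proof (rule sorted_distinct_set_unique)
    have "sorted_wrt (<) (map ?f [0..<CARD('n)])"
      unfolding sorted_wrt_iff_nth_less
      using t_index_less[OF assms(1)] by (auto intro!: nth_index_mono)
    then show "sorted (map ?f [0..<CARD('n)])" "distinct (map ?f [0..<CARD('n)])"
      by (simp_all only: strict_sorted_iff)
  qed (auto simp: t_slots_def)
  then show ?thesis using assms by (simp add: nth_index_def)
qed

lemma block_form_eq_minor_form:
  assumes "j < k"
  shows "block_form j (x_slot ` I \<union> t_slots j) = minor_form j I"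
proof (cases "card I = r")
  case True
  have card: "card (x_slot ` I) = r" "card (t_slots j) = CARD('n)"
    using True card_image[OF strict_mono_imp_inj_on[OF strict_mono_x_slot], of I] card_t_slots[OF assms] by auto
  have rn: "r + CARD('n) = CARD('m)" using card_less by (simp add: r_def)
  have "A $ slot (j * CARD('m) + pos a) $ nth_index (x_slot ` I \<union> t_slots j) (pos b) =
      (if pos b < r then P j (nth_index I (pos b)) else Q j (slot (pos b - r))) $ a" for a b :: 'm
  proof (cases "pos b < r")
    case True
    then have "nth_index (x_slot ` I \<union> t_slots j) (pos b) = x_slot (nth_index I (pos b))"
      using x_slot_less_t_slots[OF assms] card rn \<open>card I = r\<close>
      by (subst nth_index_Un) (auto simp: nth_index_image[OF strict_mono_x_slot])
    then show ?thesis
      using True x_entry[OF assms, of a] by (simp add: x_slot_def)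
  next
    case False
    then have b: "pos b - r < CARD('n)" using pos_less_card[of b] rn by linarith
    then have "nth_index (x_slot ` I \<union> t_slots j) (pos b) = slot (CARD('b) + (j * CARD('n) + (pos b - r)))"
      using False x_slot_less_t_slots[OF assms] card rn pos_less_card[of b]
      by (subst nth_index_Un) (auto simp: nth_index_t_slots[OF assms])
    then show ?thesis
      using False b t_entry[OF assms assms, of a "slot (pos b - r)"] by simp
  qed
  moreover have "card (x_slot ` I \<union> t_slots j) = CARD('m)"
    using True card_x_t_slots[OF assms] rn by simp
  ultimately show ?thesis
    using True by (simp add: block_form_eq_det minor_form_def)
next
  case False
  then have "card (x_slot ` I \<union> t_slots j) \<noteq> CARD('m)"
    using card_x_t_slots[OF assms] card_less by (simp add: r_def)
  then show ?thesis
    using False homogeneous_block_form by (auto simp: homogeneous_def minor_form_def)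
qed

text \<open>In the product of the block forms the columns \<open>t\<^sub>j\<close> can only go to the \<open>j\<close>-th factor, so that
  what is distributed among the factors are the columns of \<open>x\<close>.  The \<open>t\<^sub>j\<close>-columns produce
  inversions only with the \<open>x\<close>-columns given to later factors, and the number of the latter is the
  same for all terms that are not zero.\<close>

lemma wedge_list_block_form:
  assumes "sorted_wrt (<) js" "set js \<subseteq> {..<k}"
  shows "\<exists>\<epsilon>. \<bar>\<epsilon>\<bar> = 1 \<and> (\<forall>I. card I = length js * r \<longrightarrow>
    wedge_list (map block_form js) (x_slot ` I \<union> (\<Union>j\<in>set js. t_slots j)) =
    \<epsilon> * wedge_list (map minor_form js) I)"
  using assms
proof (induction js)
  case Nil
  then show ?case by (intro exI[of _ 1]) (simp add: dx_def)
next
  case (Cons j js)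
  then obtain \<epsilon> where \<epsilon>: "\<bar>\<epsilon>\<bar> = 1" "\<And>I. card I = length js * r \<Longrightarrow>
      wedge_list (map block_form js) (x_slot ` I \<union> (\<Union>j\<in>set js. t_slots j)) =
      \<epsilon> * wedge_list (map minor_form js) I"
    by auto
  define S where "S = (\<Union>j\<in>set js. t_slots j)"
  define \<sigma> :: real where "\<sigma> = (-1) ^ (CARD('n) * (length js * r))"
  have j: "j < k" and js: "\<And>j'. j' \<in> set js \<Longrightarrow> j < j' \<and> j' < k"
    using Cons.prems by auto
  have T_less_S: "c < c'" if "c \<in> t_slots j" "c' \<in> S" for c c'
    using that js t_slots_less[of j _ c c'] by (auto simp: S_def)
  have x_less_S: "x_slot i < c'" if "c' \<in> S" for i c'
    using that js x_slot_less_t_slots by (auto simp: S_def)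
  have disj: "t_slots j \<inter> S = {}" "\<And>I. x_slot ` I \<inter> S = {}" "\<And>I. x_slot ` I \<inter> t_slots j = {}"
    using T_less_S x_less_S x_slot_t_slots_disjoint[OF j] by blast+
  have inj_x: "inj_on x_slot I" for I
    using strict_mono_imp_inj_on[OF strict_mono_x_slot] .
  have "wedge_list (map block_form (j # js)) (x_slot ` I \<union> (\<Union>j\<in>set (j # js). t_slots j)) =
      (\<sigma> * \<epsilon>) * wedge_list (map minor_form (j # js)) I" if I: "card I = length (j # js) * r" for I
  proof -
    define K where "K = x_slot ` I \<union> t_slots j \<union> S"
    define W where "W = wedge_list (map block_form js)"
    let ?term = "\<lambda>J. (-1) ^ inversions J (K - J) * block_form j J * W (K - J)"
    let ?ext = "\<lambda>I'. x_slot ` I' \<union> t_slots j"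
    have "wedge_list (map block_form (j # js)) (x_slot ` I \<union> (\<Union>j\<in>set (j # js). t_slots j)) =
        wedge (block_form j) W K"
      by (simp add: W_def K_def S_def Un_assoc)
    also have "\<dots> = sum ?term (Pow K)"
      by (simp add: wedge_def)
    also have "\<dots> = sum ?term (?ext ` Pow I)"
    proof (rule sum.mono_neutral_right)
      show "?ext ` Pow I \<subseteq> Pow K" by (auto simp: K_def)
      show "\<forall>J\<in>Pow K - ?ext ` Pow I. ?term J = 0"
      proof
        fix J assume J: "J \<in> Pow K - ?ext ` Pow I"
        consider "J \<inter> S \<noteq> {}" | "\<not> t_slots j \<subseteq> J" | "J \<inter> S = {}" "t_slots j \<subseteq> J" by blast
        then show "?term J = 0"
        proof cases
          case 1
          then obtain j' where "j' \<in> set js" "J \<inter> t_slots j' \<noteq> {}" by (auto simp: S_def)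
          then have "block_form j J = 0"
            using j js[of j'] by (intro block_form_eq_0_if_meets[of j j']) auto
          then show ?thesis by simp
        next
          case 2
          then have "(K - J) \<inter> t_slots j \<noteq> {}" by (auto simp: K_def)
          then have "W (K - J) = 0"
            unfolding W_def using j js
            by (intro wedge_list_eq_0_if_meets[of _ "t_slots j"])
               (auto intro!: block_form_eq_0_if_meets[of _ j])
          then show ?thesis by simp
        next
          case 3
          then have "J = ?ext {i \<in> I. x_slot i \<in> J}" using J by (auto simp: K_def)
          then have "J \<in> ?ext ` Pow I" by blast
          with J show ?thesis by simp
        qed
      qed
    qed simp
    also have "\<dots> = (\<Sum>I'\<in>Pow I. ?term (?ext I'))"
    proof (rule sum.reindex_cong[OF _ refl refl])
      show "inj_on ?ext (Pow I)"
      proof (rule inj_onI)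
        fix I' I'' assume "?ext I' = ?ext I''"
        then have "x_slot ` I' = x_slot ` I''" using disj(3) by blast
        then show "I' = I''" using inj_x[of UNIV] by (simp add: inj_image_eq_iff)
      qed
    qed
    also have "\<dots> = (\<Sum>I'\<in>Pow I. (\<sigma> * \<epsilon>) *
        ((-1) ^ inversions I' (I - I') * minor_form j I' * wedge_list (map minor_form js) (I - I')))"
    proof (intro sum.cong refl)
      fix I' assume I': "I' \<in> Pow I"
      show "?term (?ext I') = (\<sigma> * \<epsilon>) *
        ((-1) ^ inversions I' (I - I') * minor_form j I' * wedge_list (map minor_form js) (I - I'))"
      proof (cases "card I' = r")
        case True
        have rest: "K - ?ext I' = x_slot ` (I - I') \<union> S"
        proof -
          have "x_slot ` (I - I') = x_slot ` I - x_slot ` I'"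
            by (rule image_set_diff[OF inj_x])
          then show ?thesis
            using disj(1) disj(2)[of I'] disj(2)[of I] disj(3)[of I] unfolding K_def by blast
        qed
        have card_rest: "card (I - I') = length js * r"
          using I I' True by (simp add: card_Diff_subset)
        have "inversions (x_slot ` I') S = 0" "inversions (t_slots j) S = 0"
          using x_less_S T_less_S by (auto intro!: inversions_ordered)
        moreover have "inversions (t_slots j) (x_slot ` (I - I')) = CARD('n) * (length js * r)"
          using x_slot_less_t_slots[OF j] card_rest inj_x
          by (subst inversions_reverse_ordered) (auto simp: card_t_slots[OF j] card_image)
        ultimately have "inversions (?ext I') (K - ?ext I') = inversions I' (I - I') + CARD('n) * (length js * r)"
          unfolding rest using disj
          by (simp add: inversions_Un_left inversions_Un_right inversions_image[OF strict_mono_x_slot])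
        moreover have "W (K - ?ext I') = \<epsilon> * wedge_list (map minor_form js) (I - I')"
          unfolding rest W_def S_def using card_rest by (rule \<epsilon>(2))
        ultimately show ?thesis
          by (simp add: block_form_eq_minor_form[OF j] \<sigma>_def power_add)
      next
        case False
        then have "minor_form j I' = 0" by (simp add: minor_form_def)
        then show ?thesis by (simp add: block_form_eq_minor_form[OF j])
      qed
    qed
    also have "\<dots> = (\<sigma> * \<epsilon>) * wedge_list (map minor_form (j # js)) I"
      by (simp add: wedge_def sum_distrib_left)
    finally show ?thesis .
  qed
  moreover have "\<bar>\<sigma> * \<epsilon>\<bar> = 1"
    using \<epsilon>(1) by (simp add: abs_mult \<sigma>_def power_abs)
  ultimately show ?case by blast
qed

theorem abs_det_eq_wedge_minor_forms: "\<bar>det A\<bar> = \<bar>wedge_list (map minor_form [0..<k]) UNIV\<bar>"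
proof -
  have "det A = wedge_list (map row_form [0..<CARD('i)]) UNIV"
    using det_eq_wedge_list_covector[of "UNIV::'i set" "\<lambda>a c. A $ slot a $ c", where 'd = 'i]
    by (simp add: row_form_def[abs_def])
  also have "map row_form [0..<CARD('i)] =
      concat (map (\<lambda>j. map (\<lambda>a. row_form (j * CARD('m) + a)) [0..<CARD('m)]) [0..<k])"
    unfolding card_i upt_mult_eq_concat[of k "CARD('m)"] by (simp add: map_concat o_def)
  also have "wedge_list \<dots> = wedge_list (map block_form [0..<k])"
    by (simp add: wedge_list_concat block_form_def[abs_def] o_def)
  finally have det: "det A = wedge_list (map block_form [0..<k]) UNIV" .
  obtain \<epsilon> where "\<bar>\<epsilon>\<bar> = 1" "\<And>I. card I = length [0..<k] * r \<Longrightarrow>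
      wedge_list (map block_form [0..<k]) (x_slot ` I \<union> (\<Union>j\<in>set [0..<k]. t_slots j)) =
      \<epsilon> * wedge_list (map minor_form [0..<k]) I"
  proof -
    have "sorted_wrt (<) [0..<k]" "set [0..<k] \<subseteq> {..<k}" by auto
    from wedge_list_block_form[OF this] that show thesis by blast
  qed
  from this(1) this(2)[of UNIV] show ?thesis
    using slots_cover unfolding det
    by (simp add: card_b r_def mult.commute abs_mult atLeast0LessThan)
qed

end

section \<open>Polynomial functions and their coefficients\<close>

text \<open>Bounding the degree in each coordinate separately, rather than the total degree, makes the
  exponents range over a cube, so that the dimension count below is a comparison of powers.\<close>

definition coord_poly :: "nat \<Rightarrow> ('a::euclidean_space \<Rightarrow> real) \<Rightarrow> bool" where
  "coord_poly D g \<longleftrightarrow>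
     (\<exists>c. \<forall>z. g z = (\<Sum>e\<in>Basis \<rightarrow>\<^sub>E {..D}. c e * (\<Prod>b\<in>Basis. (z \<bullet> b) ^ e b)))"

lemma finite_exponents [simp]: "finite (Basis \<rightarrow>\<^sub>E {..D::nat} :: ('a::euclidean_space \<Rightarrow> nat) set)"
  by (intro finite_PiE) auto

lemma coord_poly_sum:
  assumes "\<And>i. i \<in> A \<Longrightarrow> coord_poly D (g i)"
  shows "coord_poly D (\<lambda>z. \<Sum>i\<in>A. g i z)"
proof -
  have "\<forall>i\<in>A. \<exists>c. \<forall>z. g i z = (\<Sum>e\<in>Basis \<rightarrow>\<^sub>E {..D}. c e * (\<Prod>b\<in>Basis. (z \<bullet> b) ^ e b))"
    using assms unfolding coord_poly_def by blast
  from bchoice[OF this]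
  obtain c where c: "\<And>i z. i \<in> A \<Longrightarrow> g i z = (\<Sum>e\<in>Basis \<rightarrow>\<^sub>E {..D}. c i e * (\<Prod>b\<in>Basis. (z \<bullet> b) ^ e b))"
    by blast
  have "(\<Sum>i\<in>A. g i z) = (\<Sum>e\<in>Basis \<rightarrow>\<^sub>E {..D}. (\<Sum>i\<in>A. c i e) * (\<Prod>b\<in>Basis. (z \<bullet> b) ^ e b))" for z
    by (subst sum.cong[OF refl c]) (auto simp: sum_distrib_right sum.swap[of _ A])
  then show ?thesis
    unfolding coord_poly_def by (intro exI[of _ "\<lambda>e. \<Sum>i\<in>A. c i e"]) blast
qed

lemma coord_poly_cmult:
  assumes "coord_poly D g"
  shows "coord_poly D (\<lambda>z. a * g z)"
proof -
  obtain c where c: "\<And>z. g z = (\<Sum>e\<in>Basis \<rightarrow>\<^sub>E {..D}. c e * (\<Prod>b\<in>Basis. (z \<bullet> b) ^ e b))"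
    using assms unfolding coord_poly_def by metis
  have "a * g z = (\<Sum>e\<in>Basis \<rightarrow>\<^sub>E {..D}. (a * c e) * (\<Prod>b\<in>Basis. (z \<bullet> b) ^ e b))" for z
    by (simp add: c sum_distrib_left mult_ac)
  then show ?thesis
    unfolding coord_poly_def by (intro exI[of _ "\<lambda>e. a * c e"]) blast
qed

lemma coord_poly_monomial:
  fixes e :: "'a::euclidean_space \<Rightarrow> nat"
  assumes "\<And>b. b \<in> Basis \<Longrightarrow> e b \<le> D"
  shows "coord_poly D (\<lambda>z::'a. \<Prod>b\<in>Basis. (z \<bullet> b) ^ e b)"
  unfolding coord_poly_def
proof (intro exI allI)
  fix z :: 'a
  have "restrict e Basis \<in> Basis \<rightarrow>\<^sub>E {..D}"
    using assms by auto
  then show "(\<Prod>b\<in>Basis. (z \<bullet> b) ^ e b) =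
      (\<Sum>e'\<in>Basis \<rightarrow>\<^sub>E {..D}. (if e' = restrict e Basis then 1 else 0) * (\<Prod>b\<in>Basis. (z \<bullet> b) ^ e' b))"
    by (simp add: if_distrib[of "\<lambda>x. x * _"] cong: if_cong)
qed

lemma coord_poly_mult:
  assumes "coord_poly D f" "coord_poly D' g"
  shows "coord_poly (D + D') (\<lambda>z. f z * g z)"
proof -
  obtain c where c: "\<And>z. f z = (\<Sum>e\<in>Basis \<rightarrow>\<^sub>E {..D}. c e * (\<Prod>b\<in>Basis. (z \<bullet> b) ^ e b))"
    using assms unfolding coord_poly_def by metis
  obtain c' where c': "\<And>z. g z = (\<Sum>e\<in>Basis \<rightarrow>\<^sub>E {..D'}. c' e * (\<Prod>b\<in>Basis. (z \<bullet> b) ^ e b))"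
    using assms unfolding coord_poly_def by metis
  have "f z * g z = (\<Sum>e\<in>Basis \<rightarrow>\<^sub>E {..D}. \<Sum>e'\<in>Basis \<rightarrow>\<^sub>E {..D'}.
      (c e * c' e') * (\<Prod>b\<in>Basis. (z \<bullet> b) ^ (e b + e' b)))" for z
    unfolding c c' sum_product by (simp add: power_add prod.distrib mult_ac)
  moreover have "coord_poly (D + D') (\<lambda>z. \<Sum>e\<in>Basis \<rightarrow>\<^sub>E {..D}. \<Sum>e'\<in>Basis \<rightarrow>\<^sub>E {..D'}.
      (c e * c' e') * (\<Prod>b\<in>Basis. (z \<bullet> b) ^ (e b + e' b)))"
    by (intro coord_poly_sum coord_poly_cmult coord_poly_monomial add_mono)
       (auto simp: PiE_iff)
  ultimately show ?thesis by presburger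
qed

lemma coord_poly_const: "coord_poly D (\<lambda>z::'a::euclidean_space. a)"
  using coord_poly_cmult[OF coord_poly_monomial[of "\<lambda>_::'a. 0" D], of a] by simp

lemma coord_poly_mono:
  assumes "coord_poly D g" "D \<le> D'"
  shows "coord_poly D' g"
  using coord_poly_mult[OF assms(1) coord_poly_const[of "D' - D" 1]] assms(2) by simp

lemma coord_poly_inner: "coord_poly 1 (\<lambda>z::'a::euclidean_space. z \<bullet> a)"
proof -
  have coord: "coord_poly 1 (\<lambda>z::'a. z \<bullet> b)" if b: "b \<in> Basis" for b
  proof -
    have "(\<Prod>b'\<in>Basis. (z \<bullet> b') ^ (if b' = b then 1 else 0)) = z \<bullet> b" for z
      using b by (simp add: if_distrib[of "power _"] prod.delta cong: if_cong)
    then show ?thesis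
      using coord_poly_monomial[of "\<lambda>b'. if b' = b then 1 else 0" 1] by simp
  qed
  have "coord_poly 1 (\<lambda>z::'a. \<Sum>b\<in>Basis. (a \<bullet> b) * (z \<bullet> b))"
    by (intro coord_poly_sum coord_poly_cmult coord)
  then show ?thesis
    by (subst euclidean_inner) (simp add: mult.commute)
qed

lemma coord_poly_power:
  assumes "coord_poly D g"
  shows "coord_poly (n * D) (\<lambda>z. g z ^ n)"
  by (induction n) (auto intro: coord_poly_const coord_poly_mult assms)

lemma coord_poly_prod:
  assumes "finite A" "\<And>i. i \<in> A \<Longrightarrow> coord_poly D (g i)"
  shows "coord_poly (card A * D) (\<lambda>z. \<Prod>i\<in>A. g i z)"
  using assms
  by (induction A rule: finite_induct) (auto intro: coord_poly_const coord_poly_mult)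

lemma coord_poly_monomial_of:
  fixes f :: "'a::euclidean_space \<Rightarrow> 'c::euclidean_space"
  assumes "\<And>b. b \<in> Basis \<Longrightarrow> coord_poly D (\<lambda>z. f z \<bullet> b)" "\<And>b. b \<in> Basis \<Longrightarrow> e b \<le> d"
  shows "coord_poly (DIM('c) * (d * D)) (\<lambda>z. \<Prod>b\<in>Basis. (f z \<bullet> b) ^ e b)"
  by (intro coord_poly_prod coord_poly_mono[OF coord_poly_power]) (auto intro: assms mult_right_mono)

section \<open>Fibres of a polynomial map\<close>

lemma homogeneous_system_nontrivial_solution:
  fixes M :: "'i \<Rightarrow> 'j \<Rightarrow> real"
  assumes "finite E" "finite A" "card E < card A"
  shows "\<exists>c. (\<exists>a\<in>A. c a \<noteq> 0) \<and> (\<forall>e\<in>E. (\<Sum>a\<in>A. c a * M a e) = 0)"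
  using assms
proof (induction E arbitrary: A M rule: finite_induct)
  case empty
  then show ?case by (intro exI[of _ "\<lambda>_. 1"]) (auto simp: card_gt_0_iff)
next
  case (insert e E)
  show ?case
  proof (cases "\<forall>a\<in>A. M a e = 0")
    case True
    with insert.IH[of A M] insert.prems insert.hyps show ?thesis by auto
  next
    case False
    then obtain a0 where a0: "a0 \<in> A" "M a0 e \<noteq> 0" by auto
    define A' where "A' = A - {a0}"
    have A: "A = insert a0 A'" "finite A'" "a0 \<notin> A'"
      using a0 insert.prems by (auto simp: A'_def)
    have "card E < card A'"
      using insert.prems insert.hyps A by auto
    (* eliminate the unknown of a0 by means of equation e *)
    from insert.IH[OF \<open>finite A'\<close> this, of "\<lambda>a f. M a f - M a e / M a0 e * M a0 f"]
    obtain c where c: "\<exists>a\<in>A'. c a \<noteq> 0"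
      "\<And>f. f \<in> E \<Longrightarrow> (\<Sum>a\<in>A'. c a * (M a f - M a e / M a0 e * M a0 f)) = 0" by blast
    define r where "r = (\<Sum>a\<in>A'. c a * M a e) / M a0 e"
    have sums: "(\<Sum>a\<in>A. (c(a0 := - r)) a * M a f) = (\<Sum>a\<in>A'. c a * M a f) - r * M a0 f" for f
    proof -
      have "(\<Sum>a\<in>A'. (c(a0 := - r)) a * M a f) = (\<Sum>a\<in>A'. c a * M a f)"
        using A by (intro sum.cong) auto
      then show ?thesis using A by simp
    qed
    have "(\<Sum>a\<in>A. (c(a0 := - r)) a * M a f) = 0" if "f \<in> E" for f
    proof -
      have "(\<Sum>a\<in>A'. c a * (M a f - M a e / M a0 e * M a0 f)) = (\<Sum>a\<in>A'. c a * M a f) - r * M a0 f"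
        unfolding r_def
        by (simp add: right_diff_distrib sum_subtractf sum_distrib_left sum_distrib_right sum_divide_distrib mult_ac)
      with c(2)[OF that] show ?thesis by (subst sums) simp
    qed
    moreover have "(\<Sum>a\<in>A. (c(a0 := - r)) a * M a e) = 0"
      using a0 by (subst sums) (simp add: r_def)
    moreover have "\<exists>a\<in>A. (c(a0 := - r)) a \<noteq> 0"
      using c(1) A by auto
    ultimately show ?thesis by blast
  qed
qed

text \<open>The products of powers of \<open>u\<close> and of the components of \<open>f\<close> with exponents at most \<open>L\<close> number
  \<open>(L + 1) ^ (DIM('a) + 1)\<close>, but they lie in a space of polynomials of dimension at most a constant
  times \<open>(L + 1) ^ DIM('a)\<close>; for the stated \<open>L\<close> they are linearly dependent.\<close>

lemma polynomials_algebraically_dependent: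
  fixes f :: "'a::euclidean_space \<Rightarrow> 'a" and u :: "'a \<Rightarrow> real"
  assumes f: "\<And>b. b \<in> Basis \<Longrightarrow> coord_poly D (\<lambda>z. f z \<bullet> b)" and u: "coord_poly 1 u"
  defines "L \<equiv> (1 + DIM('a) * D) ^ DIM('a)"
  shows "\<exists>c. (\<exists>j\<le>L. \<exists>e\<in>Basis \<rightarrow>\<^sub>E {..L}. c j e \<noteq> 0) \<and>
    (\<forall>z. (\<Sum>j\<le>L. (\<Sum>e\<in>Basis \<rightarrow>\<^sub>E {..L}. c j e * (\<Prod>b\<in>Basis. (f z \<bullet> b) ^ e b)) * u z ^ j) = 0)"
proof -
  define B where "B = 1 + DIM('a) * D"
  define A where "A = {..L} \<times> (Basis \<rightarrow>\<^sub>E {..L} :: ('a \<Rightarrow> nat) set)"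
  define E where "E = (Basis \<rightarrow>\<^sub>E {..L * B} :: ('a \<Rightarrow> nat) set)"
  define G where "G = (\<lambda>(j, e) z. u z ^ j * (\<Prod>b\<in>Basis. (f z \<bullet> b) ^ e b))"
  have fin: "finite E" "finite A"
    by (auto simp: A_def E_def)
  have "coord_poly (L * B) (G a)" if "a \<in> A" for a
  proof -
    obtain j e where a: "a = (j, e)" by (cases a)
    with that have je: "j \<le> L" "\<And>b. b \<in> Basis \<Longrightarrow> e b \<le> L"
      by (auto simp: A_def PiE_iff)
    have "coord_poly (L + DIM('a) * (L * D)) (\<lambda>z. u z ^ j * (\<Prod>b\<in>Basis. (f z \<bullet> b) ^ e b))"
      by (intro coord_poly_mult coord_poly_monomial_of coord_poly_mono[OF coord_poly_power[OF u]])
         (use je f in auto)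
    moreover have "L + DIM('a) * (L * D) = L * B"
      by (simp add: B_def algebra_simps)
    ultimately show ?thesis by (simp add: G_def a)
  qed
  then have "\<forall>a\<in>A. \<exists>c. \<forall>z. G a z = (\<Sum>e\<in>E. c e * (\<Prod>b\<in>Basis. (z \<bullet> b) ^ e b))"
    unfolding coord_poly_def E_def by blast
  from bchoice[OF this]
  obtain M where M: "\<And>a z. a \<in> A \<Longrightarrow> G a z = (\<Sum>e\<in>E. M a e * (\<Prod>b\<in>Basis. (z \<bullet> b) ^ e b))"
    by blast
  have "card E = (L * B + 1) ^ DIM('a)"
    by (simp add: E_def card_PiE)
  also have "\<dots> \<le> ((L + 1) * B) ^ DIM('a)"
    by (intro power_mono) (auto simp: B_def)
  also have "\<dots> = (L + 1) ^ DIM('a) * L"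
    by (simp only: L_def B_def power_mult_distrib)
  also have "\<dots> < (L + 1) ^ DIM('a) * (L + 1)"
    by simp
  also have "\<dots> = card A"
    by (simp add: A_def card_PiE card_cartesian_product mult.commute)
  finally obtain c where c: "\<exists>a\<in>A. c a \<noteq> 0" "\<And>e. e \<in> E \<Longrightarrow> (\<Sum>a\<in>A. c a * M a e) = 0"
    using homogeneous_system_nontrivial_solution[OF fin, of M] by blast
  have "(\<Sum>j\<le>L. (\<Sum>e\<in>Basis \<rightarrow>\<^sub>E {..L}. c (j, e) * (\<Prod>b\<in>Basis. (f z \<bullet> b) ^ e b)) * u z ^ j) = 0" for z
  proof -
    have "(\<Sum>j\<le>L. (\<Sum>e\<in>Basis \<rightarrow>\<^sub>E {..L}. c (j, e) * (\<Prod>b\<in>Basis. (f z \<bullet> b) ^ e b)) * u z ^ j) =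
        (\<Sum>a\<in>A. c a * G a z)"
      unfolding A_def G_def sum_distrib_right sum.cartesian_product
      by (intro sum.cong refl) (auto simp: mult_ac)
    also have "\<dots> = (\<Sum>a\<in>A. \<Sum>e\<in>E. c a * M a e * (\<Prod>b\<in>Basis. (z \<bullet> b) ^ e b))"
      by (intro sum.cong refl) (simp add: M sum_distrib_left mult_ac)
    also have "\<dots> = (\<Sum>e\<in>E. (\<Sum>a\<in>A. c a * M a e) * (\<Prod>b\<in>Basis. (z \<bullet> b) ^ e b))"
      by (subst sum.swap) (simp add: sum_distrib_right)
    also have "\<dots> = 0" by (simp add: c)
    finally show ?thesis .
  qed
  then show ?thesis
    using c(1) by (intro exI[of _ "\<lambda>j e. c (j, e)"]) (auto simp: A_def)
qed

text \<open>Fubini and induction on the number of variables: for almost every value of the other variables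
  some coefficient in the last variable is nonzero, and then only finitely many values of that
  variable are zeros.\<close>

lemma AE_polynomial_nonzero_PiM:
  fixes c :: "('i \<Rightarrow> nat) \<Rightarrow> real"
  assumes "finite I" "\<exists>e\<in>I \<rightarrow>\<^sub>E {..D}. c e \<noteq> 0"
  shows "AE x in (\<Pi>\<^sub>M i\<in>I. lborel). (\<Sum>e\<in>I \<rightarrow>\<^sub>E {..D}. c e * (\<Prod>i\<in>I. x i ^ e i)) \<noteq> 0"
  using assms
proof (induction I arbitrary: c rule: finite_induct)
  case empty
  then show ?case by simp
next
  case (insert i I)
  interpret product_sigma_finite "\<lambda>_::'i. lborel :: real measure" ..
  let ?p = "\<lambda>x. \<Sum>e\<in>insert i I \<rightarrow>\<^sub>E {..D}. c e * (\<Prod>i\<in>insert i I. x i ^ e i)"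
  define q where "q j x = (\<Sum>e\<in>I \<rightarrow>\<^sub>E {..D}. c (e(i := j)) * (\<Prod>i\<in>I. x i ^ e i))" for j and x :: "'i \<Rightarrow> real"
  have fin: "finite (I \<rightarrow>\<^sub>E {..D})"
    using insert.hyps by (intro finite_PiE) auto
  have p: "?p (x(i := y)) = (\<Sum>j\<le>D. q j x * y ^ j)" for x y
  proof -
    have "(\<Prod>k\<in>I. (x(i := y)) k ^ (e(i := j)) k) = (\<Prod>k\<in>I. x k ^ e k)" for e :: "'i \<Rightarrow> nat" and j
      using insert.hyps by (intro prod.cong) auto
    moreover have "inj_on (\<lambda>(j, e). e(i := j)) ({..D} \<times> (I \<rightarrow>\<^sub>E {..D}))"
      using insert.hyps by (intro inj_on_subset[OF inj_combinator[of i I "\<lambda>_. {..D}"]]) auto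
    ultimately have "?p (x(i := y)) =
        (\<Sum>(j, e)\<in>{..D} \<times> (I \<rightarrow>\<^sub>E {..D}). c (e(i := j)) * (\<Prod>k\<in>I. x k ^ e k) * y ^ j)"
      unfolding PiE_insert_eq
      by (subst sum.reindex) (use insert.hyps in \<open>auto simp: mult_ac intro!: sum.cong\<close>)
    then show ?thesis
      by (simp add: q_def sum_distrib_right sum.cartesian_product)
  qed
  obtain e0 where e0: "e0 \<in> insert i I \<rightarrow>\<^sub>E {..D}" "c e0 \<noteq> 0"
    using insert.prems by auto
  then obtain j0 e1 where j0: "j0 \<le> D" "e1 \<in> I \<rightarrow>\<^sub>E {..D}" "e0 = e1(i := j0)"
    by (auto simp: PiE_insert_eq)
  have "AE x in (\<Pi>\<^sub>M i\<in>I. lborel). q j0 x \<noteq> 0"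
    unfolding q_def using e0 j0 by (intro insert.IH bexI[of _ e1]) (simp_all del: fun_upd_apply)
  then have inner: "AE x in (\<Pi>\<^sub>M i\<in>I. lborel). (\<integral>\<^sup>+ y. indicator {x. ?p x = 0} (x(i := y)) \<partial>lborel) = 0"
  proof eventually_elim
    case (elim x)
    have "finite {y. (\<Sum>j\<le>D. q j x * y ^ j) = 0}"
      using elim j0 by (intro polyfun_rootbound_finite) auto
    then have "{y. (\<Sum>j\<le>D. q j x * y ^ j) = 0} \<in> null_sets lborel"
      by (rule finite_imp_null_set_lborel)
    then have "AE y in lborel. (indicator {x. ?p x = 0} (x(i := y)) :: ennreal) = 0"
      by (rule AE_I') (auto simp: p indicator_def simp del: fun_upd_apply)
    then have "(\<integral>\<^sup>+ y. indicator {x. ?p x = 0} (x(i := y)) \<partial>lborel) = (\<integral>\<^sup>+ y. 0 \<partial>(lborel::real measure))"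
      by (intro nn_integral_cong_AE)
    then show ?case by simp
  qed
  have meas: "?p \<in> borel_measurable (\<Pi>\<^sub>M i\<in>insert i I. lborel)"
    by measurable
  then have "(\<integral>\<^sup>+ x. indicator {x. ?p x = 0} x \<partial>(\<Pi>\<^sub>M i\<in>insert i I. lborel)) =
      (\<integral>\<^sup>+ x. (\<integral>\<^sup>+ y. indicator {x. ?p x = 0} (x(i := y)) \<partial>lborel) \<partial>(\<Pi>\<^sub>M i\<in>I. lborel))"
    by (intro product_nn_integral_insert insert.hyps) measurable
  also have "\<dots> = (\<integral>\<^sup>+ x. 0 \<partial>(\<Pi>\<^sub>M i\<in>I. lborel :: real measure))"
    using inner by (intro nn_integral_cong_AE)
  finally have "(\<integral>\<^sup>+ x. indicator {x. ?p x = 0} x \<partial>(\<Pi>\<^sub>M i\<in>insert i I. lborel)) = 0"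
    by simp
  then have "AE x in (\<Pi>\<^sub>M i\<in>insert i I. lborel). (indicator {x. ?p x = 0} x :: ennreal) = 0"
    using meas by (subst (asm) nn_integral_0_iff_AE) measurable
  then show ?case
    by eventually_elim (auto simp: indicator_def)
qed

lemma AE_polynomial_nonzero:
  fixes c :: "('a::euclidean_space \<Rightarrow> nat) \<Rightarrow> real"
  assumes "\<exists>e\<in>Basis \<rightarrow>\<^sub>E {..D}. c e \<noteq> 0"
  shows "AE y in lborel. (\<Sum>e\<in>Basis \<rightarrow>\<^sub>E {..D}. c e * (\<Prod>b\<in>Basis. (y \<bullet> b) ^ e b)) \<noteq> 0"
proof (subst lborel_eq, subst AE_distr_iff)
  show "{x \<in> space borel. (\<Sum>e\<in>Basis \<rightarrow>\<^sub>E {..D}. c e * (\<Prod>b\<in>Basis. (x \<bullet> b) ^ e b)) \<noteq> 0} \<in> sets borel"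
    by measurable
  show "AE x in Pi\<^sub>M Basis (\<lambda>b. lborel). (\<Sum>e\<in>Basis \<rightarrow>\<^sub>E {..D}. c e *
      (\<Prod>b\<in>Basis. ((\<Sum>b\<in>Basis. x b *\<^sub>R b) \<bullet> b) ^ e b)) \<noteq> 0"
    using AE_polynomial_nonzero_PiM[OF finite_Basis assms] by (simp cong: prod.cong)
qed measurable

text \<open>Here \<open>M\<close> is the dimension, and \<open>(1 + M * D) ^ M\<close> bounds the degree, in one coordinate of the point, of
  the relations found above.\<close>

definition fibre_bound :: "nat \<Rightarrow> nat \<Rightarrow> nat" where
  "fibre_bound M D = ((1 + M * D) ^ M) ^ M"

text \<open>Each coordinate of a point in the fibre over \<open>y\<close> is a root of the polynomial in one variable
  that results from putting \<open>y\<close> for \<open>f\<close> in the algebraic relation between that coordinate and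
  the components of \<open>f\<close>; for almost every \<open>y\<close> this polynomial is not zero.\<close>

theorem AE_card_fibre_le:
  fixes f :: "'a::euclidean_space \<Rightarrow> 'a"
  assumes f: "\<And>b. b \<in> Basis \<Longrightarrow> coord_poly D (\<lambda>z. f z \<bullet> b)"
  shows "AE y in lborel. finite {z. f z = y} \<and> card {z. f z = y} \<le> fibre_bound DIM('a) D"
proof -
  define L where "L = (1 + DIM('a) * D) ^ DIM('a)"
  define P where "P c y j = (\<Sum>e\<in>Basis \<rightarrow>\<^sub>E {..L}. c j e * (\<Prod>b\<in>Basis. (y \<bullet> b) ^ e b))"
    for c :: "nat \<Rightarrow> ('a \<Rightarrow> nat) \<Rightarrow> real" and y :: 'a and j
  have "\<forall>b. \<exists>c. (\<exists>j\<le>L. \<exists>e\<in>Basis \<rightarrow>\<^sub>E {..L}. c j e \<noteq> 0) \<and> (\<forall>z. (\<Sum>j\<le>L. P c (f z) j * (z \<bullet> b) ^ j) = 0)"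
    unfolding P_def L_def by (intro allI polynomials_algebraically_dependent f coord_poly_inner)
  from choice[OF this] obtain c where c: "\<And>b. \<exists>j\<le>L. \<exists>e\<in>Basis \<rightarrow>\<^sub>E {..L}. c b j e \<noteq> 0"
    "\<And>b z. (\<Sum>j\<le>L. P (c b) (f z) j * (z \<bullet> b) ^ j) = 0" by blast
  have "AE y in lborel. \<forall>b\<in>Basis. \<exists>j\<le>L. P (c b) y j \<noteq> 0"
  proof (rule AE_finite_allI[OF finite_Basis])
    fix b
    obtain j where "j \<le> L" "\<exists>e\<in>Basis \<rightarrow>\<^sub>E {..L}. c b j e \<noteq> 0" using c(1) by blast
    then show "AE y in lborel. \<exists>j\<le>L. P (c b) y j \<noteq> 0"
      using AE_polynomial_nonzero[of L "c b j"] unfolding P_def by (auto elim!: eventually_mono)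
  qed
  then show ?thesis
  proof eventually_elim
    case (elim y)
    define R where "R b = {r. (\<Sum>j\<le>L. P (c b) y j * r ^ j) = 0}" for b
    have R: "finite (R b)" "card (R b) \<le> L" if "b \<in> Basis" for b
      unfolding R_def using elim that polyfun_rootbound[of L "P (c b) y"] by auto
    let ?g = "\<lambda>z. \<lambda>b\<in>Basis. z \<bullet> b"
    have inj: "inj_on ?g {z. f z = y}"
    proof (rule inj_onI, rule euclidean_eqI)
      fix z w b :: 'a
      assume "?g z = ?g w" "b \<in> Basis"
      then show "z \<bullet> b = w \<bullet> b" by (metis restrict_apply')
    qed
    have sub: "?g ` {z. f z = y} \<subseteq> Pi\<^sub>E Basis R"
      using c(2) by (auto simp: R_def)
    have fin: "finite (Pi\<^sub>E Basis R)"
      using R by (intro finite_PiE) auto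
    have "card {z. f z = y} \<le> card (Pi\<^sub>E Basis R)"
      using card_mono[OF fin sub] by (simp add: card_image[OF inj])
    also have "\<dots> = (\<Prod>b\<in>Basis. card (R b))"
      by (simp add: card_PiE)
    also have "\<dots> \<le> (\<Prod>b\<in>(Basis::'a set). L)"
      using R by (intro prod_mono) auto
    finally show ?case
      using finite_imageD[OF finite_subset[OF sub fin] inj] by (simp add: fibre_bound_def L_def)
  qed
qed

section \<open>The area inequality\<close>

lemma continuous_on_det_matrix:
  fixes f' :: "'z::topological_space \<Rightarrow> real^'i \<Rightarrow> real^'i::finite"
  assumes "\<And>v. continuous_on S (\<lambda>z. f' z v)"
  shows "continuous_on S (\<lambda>z. det (matrix (f' z)))"
  unfolding det_def matrix_def
  by (auto intro!: continuous_intros assms)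

lemma locally_injective_if_det_nonzero:
  fixes f :: "real^'i::finite \<Rightarrow> real^'i"
  assumes der: "\<And>z. (f has_derivative f' z) (at z)"
    and cont: "\<And>v. continuous_on UNIV (\<lambda>z. f' z v)"
    and det: "det (matrix (f' a)) \<noteq> 0"
  obtains r where "r > 0" "inj_on f (ball a r)"
proof -
  have bl: "bounded_linear (f' z)" for z
    using der has_derivative_bounded_linear by blast
  have "\<exists>B. B ** matrix (f' a) = mat 1"
    using det invertible_det_nz invertible_left_inverse by blast
  then obtain g where g: "linear g" "g \<circ> f' a = id"
    using matrix_left_invertible[of "f' a"] bounded_linear.linear[OF bl] by blast
  have "\<exists>d>0. \<forall>x. dist a x < d \<longrightarrow> onorm (\<lambda>v. f' x v - f' a v) < e" if e: "e > 0" for e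
  proof -
    let ?s = "\<lambda>x. \<Sum>b\<in>Basis. norm (f' x b - f' a b)"
    have "continuous_on UNIV ?s"
      by (intro continuous_intros cont)
    then obtain d where d: "d > 0" "\<And>x. dist x a < d \<Longrightarrow> dist (?s x) (?s a) < e"
      using e unfolding continuous_on_iff by blast
    have "onorm (\<lambda>v. f' x v - f' a v) < e" if "dist a x < d" for x
    proof -
      have "onorm (\<lambda>v. f' x v - f' a v) \<le> ?s x"
        by (intro onorm_componentwise bounded_linear_sub bl)
      also have "?s x < e"
        using d(2)[of x] that by (simp add: dist_commute dist_real_def)
      finally show ?thesis .
    qed
    with d(1) show ?thesis by blast
  qed
  then show thesis
    using has_derivative_locally_injective[of a UNIV g f' f thesis] g der that
    by (simp add: linear_conv_bounded_linear)
qed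

text \<open>The set where \<open>f\<close> is a local diffeomorphism is cut into countably many pieces on each of which
  \<open>f\<close> is injective.  On a piece the integral of the Jacobian is the measure of the image, and these
  images cover almost every point of \<open>A\<close> at most as often as it has preimages.\<close>

theorem nn_integral_Jacobian_le:
  fixes f :: "real^'i::{finite,wellorder} \<Rightarrow> real^'i::_"
  assumes der: "\<And>z. (f has_derivative f' z) (at z)"
    and cont: "\<And>v. continuous_on UNIV (\<lambda>z. f' z v)"
    and fibres: "AE y in lborel. finite {z. f z = y} \<and> card {z. f z = y} \<le> B"
    and A: "A \<in> sets borel" "emeasure lborel A < \<infinity>"
  shows "(\<integral>\<^sup>+ z. indicator A (f z) * ennreal \<bar>det (matrix (f' z))\<bar> \<partial>lborel) \<le> of_nat B * emeasure lborel A"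
proof -
  let ?J = "\<lambda>z. \<bar>det (matrix (f' z))\<bar>"
  have f_cont: "continuous_on UNIV f"
    using der by (intro continuous_at_imp_continuous_on ballI has_derivative_continuous)
  have J_meas [measurable]: "?J \<in> borel_measurable borel"
    by (intro borel_measurable_continuous_onI continuous_intros continuous_on_det_matrix cont)
  have f_meas [measurable]: "f \<in> borel_measurable borel"
    by (intro borel_measurable_continuous_onI f_cont)
  have [measurable]: "A \<in> sets borel" by (rule A(1))

  define \<F> where "\<F> = {U. open U \<and> inj_on f U}"
  obtain \<F>' where \<F>': "\<F>' \<subseteq> \<F>" "countable \<F>'" "\<Union>\<F>' = \<Union>\<F>"
    using Lindelof[of \<F>] by (auto simp: \<F>_def)
  (* the empty set is added only to make the enumeration possible when there is no piece at all *)
  define V where "V = from_nat_into (insert {} \<F>')"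
  have V_range: "range V = insert {} \<F>'"
    unfolding V_def using \<F>'(2) by (intro range_from_nat_into) auto
  then have V: "open (V n)" "inj_on f (V n)" for n
  proof -
    have "V n \<in> insert {} \<F>'" using V_range by auto
    then show "open (V n)" "inj_on f (V n)" using \<F>'(1) by (auto simp: \<F>_def)
  qed
  define S where "S n = disjointed V n \<inter> {z. f z \<in> A}" for n
  have "range (disjointed V) \<subseteq> sets borel"
    using V(1) by (intro sets.range_disjointed_sets) auto
  then have S_meas [measurable]: "S n \<in> sets borel" for n
    unfolding S_def by (intro sets.Int) auto
  have S_inj: "inj_on f (S n)" for n
    using V(2)[of n] disjointed_subset[of V n] by (auto simp: S_def intro: inj_on_subset)
  have S_disj: "disjoint_family S"
    using disjoint_family_disjointed[of V] by (auto simp: S_def disjoint_family_on_def)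

  have split: "indicator A (f z) * ennreal (?J z) = (\<Sum>n. indicator (S n) z * ennreal (?J z))" for z
  proof (cases "det (matrix (f' z)) = 0")
    case False
    obtain r where "r > 0" "inj_on f (ball z r)"
      using locally_injective_if_det_nonzero[OF der cont False] .
    then have "z \<in> \<Union>\<F>" unfolding \<F>_def by (auto intro!: exI[of _ "ball z r"])
    then have "z \<in> (\<Union>n. disjointed V n)"
      using \<F>'(3) V_range by (simp add: UN_disjointed_eq)
    then have "indicator A (f z) = (indicator (\<Union>n. S n) z :: ennreal)"
      by (auto simp: S_def indicator_def)
    also have "\<dots> = (\<Sum>n. indicator (S n) z)"
      by (rule suminf_indicator[OF S_disj, symmetric])
    finally show ?thesis by simp
  qed simp

  have image: "f ` S n \<in> sets lebesgue" "(\<integral>\<^sup>+ z. indicator (S n) z * ennreal (?J z) \<partial>lborel) =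
      (\<integral>\<^sup>+ y. indicator (f ` S n) y \<partial>lebesgue)" for n
  proof -
    have S_leb: "S n \<in> sets lebesgue" using S_meas[of n] by auto
    have der_S: "(f has_derivative f' z) (at z within S n)" for z
      using der has_derivative_at_withinI by blast
    show img: "f ` S n \<in> sets lebesgue"
      by (rule differentiable_image_in_sets_lebesgue[OF S_leb])
         (use der_S in \<open>auto simp: differentiable_on_def differentiable_def\<close>)
    have "emeasure lebesgue (f ` S n) \<le> emeasure lebesgue A"
      by (intro emeasure_mono) (auto simp: S_def A(1))
    also have "\<dots> < \<infinity>" using A by simp
    finally have lm: "f ` S n \<in> lmeasurable" using img by (auto simp: fmeasurable_def)
    then have "(?J has_integral measure lebesgue (f ` S n)) (S n)"
      using has_measure_differentiable_image[OF S_leb der_S S_inj] by blast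
    then have "(\<integral>\<^sup>+ z. ennreal (indicator (S n) z * ?J z) \<partial>lborel) = ennreal (measure lebesgue (f ` S n))"
      by (intro nn_integral_has_integral_lebesgue) auto
    also have "\<dots> = emeasure lebesgue (f ` S n)"
      using lm by (simp add: emeasure_eq_measure2)
    finally show "(\<integral>\<^sup>+ z. indicator (S n) z * ennreal (?J z) \<partial>lborel) =
      (\<integral>\<^sup>+ y. indicator (f ` S n) y \<partial>lebesgue)"
      using img by (simp add: ennreal_mult' ennreal_indicator)
  qed

  have multiplicity: "AE y in lebesgue. (\<Sum>n. indicator (f ` S n) y) \<le> of_nat B * (indicator A y :: ennreal)"
    using AE_completion[OF fibres]
  proof eventually_elim
    case (elim y)
    define N where "N = {n. y \<in> f ` S n}"
    have "\<forall>n\<in>N. \<exists>w. w \<in> S n \<and> f w = y"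
      by (auto simp: N_def)
    from bchoice[OF this] obtain z where z: "\<And>n. n \<in> N \<Longrightarrow> z n \<in> S n \<and> f (z n) = y"
      by blast
    have inj: "inj_on z N"
    proof (rule inj_onI)
      fix m n assume *: "m \<in> N" "n \<in> N" "z m = z n"
      then have "z m \<in> S m \<inter> S n" using z by (metis IntI)
      then show "m = n" using S_disj by (auto simp: disjoint_family_on_def)
    qed
    have sub: "z ` N \<subseteq> {w. f w = y}" using z by auto
    then have fin: "finite N"
      using elim inj by (metis finite_imageD finite_subset)
    have card: "card N \<le> B"
      using card_mono[OF _ sub] elim card_image[OF inj] by auto
    have "(\<Sum>n. indicator (f ` S n) y :: ennreal) = (\<Sum>n\<in>N. indicator (f ` S n) y)"
      by (intro suminf_finite fin) (auto simp: N_def)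
    also have "\<dots> = of_nat (card N)"
      by (simp add: N_def)
    also have "\<dots> \<le> of_nat B * indicator A y"
    proof (cases "N = {}")
      case False
      then have "y \<in> A" by (auto simp: N_def S_def)
      then show ?thesis using card by simp
    qed simp
    finally show ?case .
  qed

  have "(\<integral>\<^sup>+ z. indicator A (f z) * ennreal (?J z) \<partial>lborel) =
      (\<Sum>n. \<integral>\<^sup>+ z. indicator (S n) z * ennreal (?J z) \<partial>lborel)"
    unfolding split by (intro nn_integral_suminf) measurable
  also have "\<dots> = (\<integral>\<^sup>+ y. (\<Sum>n. indicator (f ` S n) y) \<partial>lebesgue)"
    unfolding image(2) using image(1) by (intro nn_integral_suminf[symmetric]) auto
  also have "\<dots> \<le> (\<integral>\<^sup>+ y. of_nat B * indicator A y \<partial>lebesgue)"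
    by (intro nn_integral_mono_AE multiplicity)
  also have "\<dots> = of_nat B * emeasure lborel A"
    using A by (subst nn_integral_cmult_indicator) auto
  finally show ?thesis .
qed

section \<open>Differentiability and degree of polynomial maps\<close>

lemma real_polynomial_function_C1:
  assumes "real_polynomial_function g"
  shows "\<exists>D. (\<forall>z. (g has_derivative D z) (at z)) \<and> (\<forall>v. continuous_on UNIV (\<lambda>z. D z v))"
  using assms
proof induction
  case (linear f)
  then show ?case
    by (intro exI[of _ "\<lambda>_. f"]) (auto intro: bounded_linear_imp_has_derivative)
next
  case (const c)
  then show ?case by (intro exI[of _ "\<lambda>_ _. 0"]) auto
next
  case (add f g)
  then obtain D D' where "\<forall>z. (f has_derivative D z) (at z)" "\<forall>v. continuous_on UNIV (\<lambda>z. D z v)"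
    "\<forall>z. (g has_derivative D' z) (at z)" "\<forall>v. continuous_on UNIV (\<lambda>z. D' z v)" by blast
  then show ?case
    by (intro exI[of _ "\<lambda>z v. D z v + D' z v"]) (auto intro!: derivative_intros continuous_intros)
next
  case (mult f g)
  then obtain D D' where D: "\<forall>z. (f has_derivative D z) (at z)" "\<forall>v. continuous_on UNIV (\<lambda>z. D z v)"
    "\<forall>z. (g has_derivative D' z) (at z)" "\<forall>v. continuous_on UNIV (\<lambda>z. D' z v)" by blast
  have "continuous_on UNIV f" "continuous_on UNIV g"
    using D by (auto intro!: continuous_at_imp_continuous_on has_derivative_continuous)
  with D show ?case
    by (intro exI[of _ "\<lambda>z v. f z * D' z v + D z v * g z"])
       (auto intro!: has_derivative_mult continuous_intros)
qed

lemma polynomial_function_C1: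
  fixes f :: "'a::euclidean_space \<Rightarrow> 'c::euclidean_space"
  assumes "polynomial_function f"
  shows "\<exists>D. (\<forall>z. (f has_derivative D z) (at z)) \<and> (\<forall>v. continuous_on UNIV (\<lambda>z. D z v))"
proof -
  have "\<forall>b\<in>Basis. \<exists>D. (\<forall>z. ((\<lambda>z. f z \<bullet> b) has_derivative D z) (at z)) \<and> (\<forall>v. continuous_on UNIV (\<lambda>z. D z v))"
    using assms by (auto simp: polynomial_function_iff_Basis_inner intro: real_polynomial_function_C1)
  from bchoice[OF this] obtain D where
    D: "\<And>b z. b \<in> Basis \<Longrightarrow> ((\<lambda>z. f z \<bullet> b) has_derivative D b z) (at z)"
       "\<And>b v. b \<in> Basis \<Longrightarrow> continuous_on UNIV (\<lambda>z. D b z v)" by blast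
  have "((\<lambda>z. \<Sum>b\<in>Basis. (f z \<bullet> b) *\<^sub>R b) has_derivative (\<lambda>v. \<Sum>b\<in>Basis. D b z v *\<^sub>R b)) (at z)" for z
    by (intro has_derivative_sum has_derivative_scaleR_left D(1))
  then have "(f has_derivative (\<lambda>v. \<Sum>b\<in>Basis. D b z v *\<^sub>R b)) (at z)" for z
    by (simp add: euclidean_representation)
  moreover have "continuous_on UNIV (\<lambda>z. \<Sum>b\<in>Basis. D b z v *\<^sub>R b)" for v
    by (intro continuous_intros D(2))
  ultimately show ?thesis by (intro exI[of _ "\<lambda>z v. \<Sum>b\<in>Basis. D b z v *\<^sub>R b"]) blast
qed

lemma coord_poly_linear:
  fixes f :: "'a::euclidean_space \<Rightarrow> real"
  assumes "bounded_linear f"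
  shows "coord_poly 1 f"
proof -
  interpret bounded_linear f by fact
  have eq: "f = (\<lambda>z. \<Sum>b\<in>Basis. f b * (z \<bullet> b))"
  proof
    fix z
    have "f z = f (\<Sum>b\<in>Basis. (z \<bullet> b) *\<^sub>R b)"
      by (simp only: euclidean_representation)
    also have "\<dots> = (\<Sum>b\<in>Basis. f b * (z \<bullet> b))"
      by (simp only: sum scaleR real_scaleR_def mult.commute)
    finally show "f z = (\<Sum>b\<in>Basis. f b * (z \<bullet> b))" .
  qed
  have "coord_poly 1 (\<lambda>z. \<Sum>b\<in>Basis. f b * (z \<bullet> b))"
    by (intro coord_poly_sum coord_poly_cmult coord_poly_inner)
  then show ?thesis
    by (rule back_subst[of "coord_poly 1", OF _ eq[symmetric]])
qed

lemma real_polynomial_function_coord_poly: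
  fixes g :: "'a::euclidean_space \<Rightarrow> real"
  assumes "real_polynomial_function g"
  shows "\<exists>D. coord_poly D g"
  using assms
proof induction
  case (add f g)
  then obtain D D' where D: "coord_poly D f" "coord_poly D' g" by blast
  have "coord_poly (max D D') (\<lambda>z. \<Sum>i\<in>{True, False}. if i then f z else g z)"
  proof (intro coord_poly_sum)
    fix i show "coord_poly (max D D') (\<lambda>z. if i then f z else g z)"
      using D by (cases i) (auto intro: coord_poly_mono)
  qed
  then show ?case by auto
qed (use coord_poly_linear coord_poly_const coord_poly_mult in blast)+

lemma polynomial_function_degree:
  fixes f :: "'a::euclidean_space \<Rightarrow> 'c::euclidean_space"
  assumes "polynomial_function f"
  shows "poly_of_degree_le (poly_map_degree f) f"
proof -
  have "\<forall>b\<in>Basis. \<exists>D. coord_poly D (\<lambda>z. f z \<bullet> b)"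
    using assms by (auto simp: polynomial_function_iff_Basis_inner intro: real_polynomial_function_coord_poly)
  from bchoice[OF this] obtain D where D: "\<And>b. b \<in> Basis \<Longrightarrow> coord_poly (D b) (\<lambda>z. f z \<bullet> b)" by blast
  define M where "M = Max (D ` Basis)"
  have "coord_poly M (\<lambda>z. f z \<bullet> b)" if "b \<in> Basis" for b
    using D[OF that] by (rule coord_poly_mono) (simp add: M_def that)
  then have "\<forall>b\<in>Basis. \<exists>c. \<forall>z. f z \<bullet> b = (\<Sum>e\<in>Basis \<rightarrow>\<^sub>E {..M}. c e * (\<Prod>b\<in>Basis. (z \<bullet> b) ^ e b))"
    by (simp add: coord_poly_def)
  from bchoice[OF this] obtain c where
    c: "\<And>b z. b \<in> Basis \<Longrightarrow> f z \<bullet> b = (\<Sum>e\<in>Basis \<rightarrow>\<^sub>E {..M}. c b e * (\<Prod>b\<in>Basis. (z \<bullet> b) ^ e b))"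
    by blast
  define c' where "c' e = (if e \<in> Basis \<rightarrow>\<^sub>E {..M} then \<Sum>b\<in>Basis. c b e *\<^sub>R b else 0)" for e
  define d where "d = DIM('a) * M"
  have "f z = (\<Sum>e \<in> {e \<in> Basis \<rightarrow>\<^sub>E {..d}. (\<Sum>b\<in>Basis. e b) \<le> d}. (\<Prod>b\<in>Basis. (z \<bullet> b) ^ e b) *\<^sub>R c' e)" for z
  proof -
    have "f z = (\<Sum>b\<in>Basis. (f z \<bullet> b) *\<^sub>R b)" by (simp add: euclidean_representation)
    also have "\<dots> = (\<Sum>b\<in>Basis. \<Sum>e\<in>Basis \<rightarrow>\<^sub>E {..M}. (\<Prod>b\<in>Basis. (z \<bullet> b) ^ e b) *\<^sub>R c b e *\<^sub>R b)"
      by (intro sum.cong refl) (simp add: c scaleR_sum_left mult.commute)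
    also have "\<dots> = (\<Sum>e\<in>Basis \<rightarrow>\<^sub>E {..M}. (\<Prod>b\<in>Basis. (z \<bullet> b) ^ e b) *\<^sub>R c' e)"
      by (subst sum.swap) (auto simp: c'_def scaleR_sum_right intro!: sum.cong)
    also have "\<dots> = (\<Sum>e \<in> {e \<in> Basis \<rightarrow>\<^sub>E {..d}. (\<Sum>b\<in>Basis. e b) \<le> d}. (\<Prod>b\<in>Basis. (z \<bullet> b) ^ e b) *\<^sub>R c' e)"
    proof (rule sum.mono_neutral_left)
      show "Basis \<rightarrow>\<^sub>E {..M} \<subseteq> {e \<in> Basis \<rightarrow>\<^sub>E {..d}. (\<Sum>b\<in>(Basis::'a set). e b) \<le> d}"
      proof
        fix e :: "'a \<Rightarrow> nat" assume e: "e \<in> Basis \<rightarrow>\<^sub>E {..M}"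
        have "(\<Sum>b\<in>Basis. e b) \<le> (\<Sum>b\<in>(Basis::'a set). M)"
          using e by (intro sum_mono) auto
        then have "(\<Sum>b\<in>Basis. e b) \<le> d" by (simp add: d_def)
        moreover have "M \<le> d" by (simp add: d_def)
        ultimately show "e \<in> {e \<in> Basis \<rightarrow>\<^sub>E {..d}. (\<Sum>b\<in>(Basis::'a set). e b) \<le> d}"
          using e by (auto simp: PiE_iff)
      qed
    qed (auto simp: c'_def)
    finally show ?thesis .
  qed
  then have "poly_of_degree_le d f" unfolding poly_of_degree_le_def by blast
  then show ?thesis unfolding poly_map_degree_def by (rule LeastI)
qed

lemma poly_of_degree_le_compose_linear:
  fixes f :: "'a::euclidean_space \<Rightarrow> 'c::euclidean_space" and L :: "'z::euclidean_space \<Rightarrow> 'a"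
  assumes "poly_of_degree_le d f" "bounded_linear L"
  shows "coord_poly (DIM('a) * d) (\<lambda>z. f (L z) \<bullet> u)"
proof -
  obtain c where c: "\<And>z. f z = (\<Sum>e \<in> {e \<in> Basis \<rightarrow>\<^sub>E {..d}. (\<Sum>b\<in>Basis. e b) \<le> d}. (\<Prod>b\<in>Basis. (z \<bullet> b) ^ e b) *\<^sub>R c e)"
    using assms(1) unfolding poly_of_degree_le_def by blast
  have lin: "coord_poly 1 (\<lambda>z. L z \<bullet> b)" for b
    by (intro coord_poly_linear bounded_linear_inner_left_comp assms(2))
  have "coord_poly (DIM('a) * (d * 1)) (\<lambda>z. \<Sum>e \<in> {e \<in> Basis \<rightarrow>\<^sub>E {..d}. (\<Sum>b\<in>Basis. e b) \<le> d}.
      (c e \<bullet> u) * (\<Prod>b\<in>Basis. (L z \<bullet> b) ^ e b))"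
    by (intro coord_poly_sum coord_poly_cmult coord_poly_monomial_of lin) auto
  then show ?thesis
    by (simp add: c inner_sum_left mult.commute)
qed

section \<open>Blocks of coordinates\<close>

text \<open>The coordinates after the first \<open>s\<close> are cut into consecutive blocks of length \<open>CARD('a)\<close>; this is
  the \<open>j\<close>-th of them.  A configuration \<open>w = (x, t\<^sub>0, \<dots>, t\<^sub>k\<^sub>-\<^sub>1)\<close> has \<open>x = block 0 0 w\<close> and
  \<open>t\<^sub>j = block CARD('b) j w\<close>, and the \<open>j\<close>-th component of a point \<open>y\<close> of the target is \<open>block 0 j y\<close>.\<close>

definition block :: "nat \<Rightarrow> nat \<Rightarrow> 'i::{finite,linorder} rvec \<Rightarrow> 'a::{finite,linorder} rvec" where
  "block s j w = (\<chi> a. w $ slot (s + (j * CARD('a) + pos a)))"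

lemma bounded_linear_block: "bounded_linear (block s j)"
  unfolding linear_conv_bounded_linear[symmetric]
  by (rule linearI) (simp_all add: block_def vec_eq_iff)

lemma block_measurable [measurable]: "block s j \<in> borel_measurable borel"
  by (intro borel_measurable_continuous_onI linear_continuous_on bounded_linear_block)

lemma block_axis:
  assumes "s + (j * CARD('a) + pos a) < CARD('i)" "s + (j' * CARD('a) + CARD('a)) \<le> CARD('i)"
  shows "block s j' (axis (slot (s + (j * CARD('a) + pos a))) 1 :: 'i::{finite,linorder} rvec) =
    (if j' = j then axis (a::'a::{finite,linorder}) 1 else 0)"
proof -
  have "slot (s + (j' * CARD('a) + pos b)) = (slot (s + (j * CARD('a) + pos a)) :: 'i) \<longleftrightarrow> j' = j \<and> b = a" for b
  proof
    assume "slot (s + (j' * CARD('a) + pos b)) = (slot (s + (j * CARD('a) + pos a)) :: 'i)"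
    then have "pos (slot (s + (j' * CARD('a) + pos b)) :: 'i) = pos (slot (s + (j * CARD('a) + pos a)) :: 'i)"
      by simp
    then have eq: "j' * CARD('a) + pos b = j * CARD('a) + pos a"
      using assms pos_less_card[of b] by simp
    then have "(j' * CARD('a) + pos b) div CARD('a) = (j * CARD('a) + pos a) div CARD('a)" by simp
    then have "j' = j"
      using pos_less_card[of a] pos_less_card[of b] by simp
    with eq show "j' = j \<and> b = a" by simp
  qed simp
  then show ?thesis by (auto simp: block_def vec_eq_iff axis_def)
qed

lemma block_axis_outside:
  assumes "p < CARD('i)" "p < s \<or> s + (j * CARD('a) + CARD('a)) \<le> p"
    "s + (j * CARD('a) + CARD('a)) \<le> CARD('i)"
  shows "(block s j (axis (slot p) 1 :: 'i::{finite,linorder} rvec) :: 'a::{finite,linorder} rvec) = 0"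
proof -
  have "slot (s + (j * CARD('a) + pos b)) \<noteq> (slot p :: 'i)" for b :: 'a
  proof
    assume "slot (s + (j * CARD('a) + pos b)) = (slot p :: 'i)"
    then have "pos (slot (s + (j * CARD('a) + pos b)) :: 'i) = pos (slot p :: 'i)" by simp
    then show False using assms pos_less_card[of b] by auto
  qed
  then show ?thesis by (auto simp: block_def vec_eq_iff axis_def)
qed

definition configuration_map ::
  "('n::{finite,linorder} rvec \<times> 'b::{finite,linorder} rvec \<Rightarrow> 'm::{finite,linorder} rvec)
     \<Rightarrow> 'i::{finite,linorder} rvec \<Rightarrow> 'i rvec" where
  "configuration_map \<gamma> w =
     (\<chi> e. \<gamma> (block CARD('b) (pos e div CARD('m)) w, block 0 0 w) $ slot (pos e mod CARD('m)))"

lemma block_configuration_map: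
  fixes \<gamma> :: "'n::{finite,linorder} rvec \<times> 'b::{finite,linorder} rvec \<Rightarrow> 'm::{finite,linorder} rvec"
    and w :: "'i::{finite,linorder} rvec"
  assumes "CARD('i) = k * CARD('m)" "j < k"
  shows "block 0 j (configuration_map \<gamma> w) = \<gamma> (block CARD('b) j w, block 0 0 w)"
proof -
  have "(j + 1) * CARD('m) \<le> k * CARD('m)"
    using assms by (intro mult_right_mono) auto
  then have "j * CARD('m) + pos a < CARD('i)" for a :: 'm
    using assms pos_less_card[of a] by (simp add: add_mult_distrib)
  then show ?thesis
    by (simp add: vec_eq_iff block_def configuration_map_def pos_less_card)
qed

definition configuration_deriv ::
  "('n::{finite,linorder} rvec \<times> 'b::{finite,linorder} rvec \<Rightarrow> 'n rvec \<times> 'b rvec \<Rightarrow> 'm::{finite,linorder} rvec)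
     \<Rightarrow> 'i::{finite,linorder} rvec \<Rightarrow> 'i rvec \<Rightarrow> 'i rvec" where
  "configuration_deriv G w h =
     (\<chi> e. G (block CARD('b) (pos e div CARD('m)) w, block 0 0 w)
              (block CARD('b) (pos e div CARD('m)) h, block 0 0 h) $ slot (pos e mod CARD('m)))"

lemma configuration_map_has_derivative:
  fixes \<gamma> :: "'n::{finite,linorder} rvec \<times> 'b::{finite,linorder} rvec \<Rightarrow> 'm::{finite,linorder} rvec"
    and w :: "'i::{finite,linorder} rvec"
  assumes "\<And>z. (\<gamma> has_derivative G z) (at z)"
  shows "(configuration_map \<gamma> has_derivative configuration_deriv G w) (at w)"
proof -
  have "((\<lambda>w. \<gamma> (block CARD('b) j w, block 0 0 w)) has_derivative
      (\<lambda>h. G (block CARD('b) j w, block 0 0 w) (block CARD('b) j h, block 0 0 h))) (at w)" for j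
    by (rule has_derivative_compose[OF _ assms])
       (intro has_derivative_Pair bounded_linear_imp_has_derivative bounded_linear_block)
  then have "((\<lambda>w. \<gamma> (block CARD('b) j w, block 0 0 w) $ a) has_derivative
      (\<lambda>h. G (block CARD('b) j w, block 0 0 w) (block CARD('b) j h, block 0 0 h) $ a)) (at w)" for j a
    by (rule bounded_linear.has_derivative[OF bounded_linear_vec_nth])
  then show ?thesis
    unfolding configuration_map_def[abs_def] configuration_deriv_def[abs_def]
    by (subst has_derivative_componentwise_within)
       (auto simp: Basis_vec_def inner_axis)
qed

lemma continuous_on_configuration_deriv:
  fixes G :: "'n::{finite,linorder} rvec \<times> 'b::{finite,linorder} rvec \<Rightarrow> 'n rvec \<times> 'b rvec \<Rightarrow> 'm::{finite,linorder} rvec"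
  assumes "\<And>v. continuous_on UNIV (\<lambda>z. G z v)"
  shows "continuous_on UNIV (\<lambda>w. configuration_deriv G w h)"
proof -
  have "continuous_on UNIV (\<lambda>w. G (block CARD('b) j w, block 0 0 w) v)" for j v
    by (rule continuous_on_compose2[OF assms])
       (intro continuous_on_Pair linear_continuous_on bounded_linear_block, simp)
  then show ?thesis
    unfolding configuration_deriv_def
    by (intro continuous_on_vec_lambda continuous_on_component)
qed

lemma partial_x_eq:
  assumes "(\<gamma> has_derivative G) (at (t, x))"
  shows "partial_x \<gamma> i t x = G (0, axis i 1)"
proof -
  have "((\<lambda>h. \<gamma> (t, x + h *\<^sub>R axis i 1)) has_derivative (\<lambda>h. G (0, h *\<^sub>R axis i 1))) (at 0)"
    by (rule has_derivative_compose[where g = \<gamma>])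
       (use assms in \<open>auto intro!: derivative_eq_intros\<close>)
  moreover have "G (0, h *\<^sub>R axis i 1) = h *\<^sub>R G (0, axis i 1)" for h
    using linear_cmul[OF has_derivative_linear[OF assms], of h "(0, axis i 1)"] by simp
  ultimately show ?thesis
    unfolding partial_x_def by (intro vector_derivative_at) (simp add: has_vector_derivative_def)
qed

lemma partial_t_eq:
  assumes "(\<gamma> has_derivative G) (at (t, x))"
  shows "partial_t \<gamma> l t x = G (axis l 1, 0)"
proof -
  have "((\<lambda>h. \<gamma> (t + h *\<^sub>R axis l 1, x)) has_derivative (\<lambda>h. G (h *\<^sub>R axis l 1, 0))) (at 0)"
    by (rule has_derivative_compose[where g = \<gamma>])
       (use assms in \<open>auto intro!: derivative_eq_intros\<close>)
  moreover have "G (h *\<^sub>R axis l 1, 0) = h *\<^sub>R G (axis l 1, 0)" for h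
    using linear_cmul[OF has_derivative_linear[OF assms], of h "(axis l 1, 0)"] by simp
  ultimately show ?thesis
    unfolding partial_t_def by (intro vector_derivative_at) (simp add: has_vector_derivative_def)
qed

text \<open>In the row \<open>(j, a)\<close> of the Jacobian matrix stand the derivatives of the component \<open>a\<close> of
  \<open>\<gamma>(t\<^sub>j, x)\<close>, which involves no other \<open>t\<^sub>j\<^sub>'\<close>; so the matrix has the shape required above, and the
  forms \<open>minor_form j\<close> are \<open>\<omega>(t\<^sub>j, x)\<close>.\<close>

theorem abs_det_configuration_deriv:
  fixes \<gamma> :: "'n::{finite,linorder} rvec \<times> 'b::{finite,linorder} rvec \<Rightarrow> 'm::{finite,linorder} rvec"
    and w :: "'i::{finite,linorder} rvec"
  assumes card: "CARD('n) < CARD('m)" "CARD('b) = (CARD('m) - CARD('n)) * k" "CARD('i) = k * CARD('m)"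
    and "0 < k" and der: "\<And>z. (\<gamma> has_derivative G z) (at z)"
  shows "\<bar>det (matrix (configuration_deriv G w))\<bar> =
    \<bar>Phi \<gamma> k (block 0 0 w) (\<lambda>j. block CARD('b) j w)\<bar>"
proof -
  define z where "z j = (block CARD('b) j w :: 'n rvec, block 0 0 w :: 'b rvec)" for j
  have total: "CARD('b) + k * CARD('n) = CARD('i)"
    using card by (simp add: diff_mult_distrib mult.commute flip: add_mult_distrib2)
  have row_less: "j * CARD('m) + pos a < CARD('i)" if "j < k" for j and a :: 'm
  proof -
    have "(j + 1) * CARD('m) \<le> k * CARD('m)" using that by (intro mult_right_mono) auto
    then show ?thesis using pos_less_card[of a] card by (simp add: add_mult_distrib)
  qed
  have t_less: "CARD('b) + (j * CARD('n) + CARD('n)) \<le> CARD('i)" if "j < k" for j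
  proof -
    have "(j + 1) * CARD('n) \<le> k * CARD('n)" using that by (intro mult_right_mono) auto
    then show ?thesis using total by (simp add: add_mult_distrib)
  qed
  have entry: "matrix (configuration_deriv G w) $ slot (j * CARD('m) + pos a) $ c =
      G (z j) (block CARD('b) j (axis c 1), block 0 0 (axis c 1)) $ a" if "j < k" for j c and a :: 'm
    using row_less[OF that, of a] pos_less_card[of a] by (simp add: matrix_def configuration_deriv_def z_def)
  interpret block_jacobian k "matrix (configuration_deriv G w)"
    "\<lambda>j i. G (z j) (0, axis i 1)" "\<lambda>j l. G (z j) (axis l 1, 0)"
  proof
    fix j and a :: 'm and i :: 'b assume j: "j < k"
    have i: "pos (i::'b) < CARD('b)" by (rule pos_less_card)
    have "block CARD('b) j (axis (slot (pos i)) 1 :: 'i rvec) = (0 :: 'n rvec)"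
      using i total t_less[OF j] by (intro block_axis_outside) auto
    moreover have "block 0 0 (axis (slot (pos i)) 1 :: 'i rvec) = axis i 1"
      using block_axis[of 0 0 i 0, where 'i = 'i] i total by simp
    ultimately show "matrix (configuration_deriv G w) $ slot (j * CARD('m) + pos a) $ slot (pos i) =
        G (z j) (0, axis i 1) $ a"
      by (simp add: entry[OF j])
  next
    fix j j' and a :: 'm and l :: 'n assume j: "j < k" "j' < k"
    have l: "CARD('b) + (j' * CARD('n) + pos l) < CARD('i)"
      using t_less[OF j(2)] pos_less_card[of l] by linarith
    have "block CARD('b) j (axis (slot (CARD('b) + (j' * CARD('n) + pos l))) 1 :: 'i rvec) =
        (if j = j' then axis l 1 else (0 :: 'n rvec))"
      using l t_less[OF j(1)] by (rule block_axis)
    moreover have "block 0 0 (axis (slot (CARD('b) + (j' * CARD('n) + pos l))) 1 :: 'i rvec) = (0 :: 'b rvec)"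
      using l total by (intro block_axis_outside) auto
    moreover have "G (z j) (0, 0) = 0"
      using linear_0[OF has_derivative_linear[OF der], of "z j"] by (simp add: zero_prod_def)
    ultimately show "matrix (configuration_deriv G w) $ slot (j * CARD('m) + pos a) $
        slot (CARD('b) + (j' * CARD('n) + pos l)) = (if j' = j then G (z j) (axis l 1, 0) $ a else 0)"
      by (auto simp: entry[OF j(1)])
  qed (use card in auto)
  have partials: "partial_x \<gamma> i (block CARD('b) j w) (block 0 0 w) = G (z j) (0, axis i 1)"
    "partial_t \<gamma> l (block CARD('b) j w) (block 0 0 w) = G (z j) (axis l 1, 0)" for i j l
    unfolding z_def by (rule partial_x_eq[OF der] partial_t_eq[OF der])+
  have "omega \<gamma> (block CARD('b) j w) (block 0 0 w) = minor_form j" for j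
    unfolding omega_def minor_form_def omega_matrix_def Let_def r_def partials ..
  then show ?thesis
    using abs_det_eq_wedge_minor_forms by (simp add: Phi_def)
qed

section \<open>Lebesgue measure in blocks of coordinates\<close>

text \<open>The configuration with the given blocks, an inverse of \<open>w \<mapsto> (block 0 0 w, \<lambda>j. block s j w)\<close>.  With
  \<open>s = 0\<close> there are only blocks of the second kind.\<close>

definition glue :: "nat \<Rightarrow> 'b::{finite,linorder} rvec \<Rightarrow> (nat \<Rightarrow> 'a::{finite,linorder} rvec) \<Rightarrow> 'i::{finite,linorder} rvec" where
  "glue s x t = (\<chi> e. if pos e < s then x $ slot (pos e)
     else t ((pos e - s) div CARD('a)) $ slot ((pos e - s) mod CARD('a)))"

lemma block_index_less:
  assumes "s + k * CARD('a::{finite,linorder}) = N" "j < k"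
  shows "s + (j * CARD('a) + pos (a::'a)) < N"
proof -
  have "(j + 1) * CARD('a) \<le> k * CARD('a)" using assms by (intro mult_right_mono) auto
  then show ?thesis using pos_less_card[of a] assms(1) by (simp add: add_mult_distrib)
qed

lemma block_glue:
  fixes t :: "nat \<Rightarrow> 'a::{finite,linorder} rvec"
  assumes "s + k * CARD('a) = CARD('i::{finite,linorder})" "j < k"
  shows "block s j (glue s x t :: 'i rvec) = t j"
  using block_index_less[OF assms] by (simp add: block_def glue_def vec_eq_iff pos_less_card)

lemma block_glue_0:
  fixes x :: "'b::{finite,linorder} rvec"
  assumes "CARD('b) \<le> CARD('i::{finite,linorder})"
  shows "block 0 0 (glue CARD('b) x t :: 'i rvec) = x"
proof -
  have "pos a < CARD('i)" for a :: 'b using pos_less_card[of a] assms by linarith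
  then show ?thesis by (simp add: block_def glue_def vec_eq_iff pos_less_card)
qed

lemma block_index_cases:
  assumes "s + k * CARD('a::{finite,linorder}) = CARD('i::{finite,linorder})"
  obtains "pos (e::'i) < s" | j and a :: "'a::{finite,linorder}" where "j < k" "e = slot (s + (j * CARD('a) + pos a))"
proof (cases "pos e < s")
  case False
  define j where "j = (pos e - s) div CARD('a)"
  define q where "q = (pos e - s) mod CARD('a)"
  have "pos e - s < k * CARD('a)" using pos_less_card[of e] assms False by linarith
  then have "j < k" by (simp add: j_def less_mult_imp_div_less)
  moreover have q: "q < CARD('a)" by (simp add: q_def)
  moreover have "pos e = s + (j * CARD('a) + q)"
    using False by (simp add: j_def q_def)
  then have "e = slot (s + (j * CARD('a) + pos (slot q :: 'a)))"
    using q by (metis nth_index_pos pos_nth_index)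
  ultimately show thesis using that(2) by blast
qed (use that in blast)

lemma mem_box_iff_blocks:
  fixes w :: "'i::{finite,linorder} rvec"
  assumes "k * CARD('a::{finite,linorder}) = CARD('i)"
  shows "w \<in> box l u \<longleftrightarrow> (\<forall>j<k. (block 0 j w :: 'a rvec) \<in> box (block 0 j l) (block 0 j u))"
proof -
  let ?P = "\<lambda>e. l $ e < w $ e \<and> w $ e < u $ e"
  have card0: "0 + k * CARD('a) = CARD('i)" using assms by simp
  have "?P e" if "\<forall>j<k. \<forall>a::'a. ?P (slot (0 + (j * CARD('a) + pos a)))" for e
    by (rule block_index_cases[OF card0, of e]) (use that in blast)+
  then have "(\<forall>e. ?P e) \<longleftrightarrow> (\<forall>j<k. \<forall>a::'a. ?P (slot (0 + (j * CARD('a) + pos a))))"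
    by blast
  then show ?thesis by (simp add: mem_box_cart block_def)
qed

lemma mem_box_iff_blocks2:
  fixes w :: "'i::{finite,linorder} rvec"
  assumes "CARD('b::{finite,linorder}) + k * CARD('a::{finite,linorder}) = CARD('i)"
  shows "w \<in> box l u \<longleftrightarrow> (block 0 0 w :: 'b rvec) \<in> box (block 0 0 l) (block 0 0 u) \<and>
    (\<forall>j<k. (block CARD('b) j w :: 'a rvec) \<in> box (block CARD('b) j l) (block CARD('b) j u))"
proof -
  let ?P = "\<lambda>e. l $ e < w $ e \<and> w $ e < u $ e"
  have "?P e" if "\<forall>i::'b. ?P (slot (pos i))" "\<forall>j<k. \<forall>a::'a. ?P (slot (CARD('b) + (j * CARD('a) + pos a)))" for e
  proof (rule block_index_cases[OF assms, of e])
    assume "pos e < CARD('b)"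
    then have "e = slot (pos (slot (pos e) :: 'b))" by simp
    then show "?P e" using that(1) by metis
  qed (use that(2) in blast)
  then have "(\<forall>e. ?P e) \<longleftrightarrow> (\<forall>i::'b. ?P (slot (pos i))) \<and>
      (\<forall>j<k. \<forall>a::'a. ?P (slot (CARD('b) + (j * CARD('a) + pos a))))"
    by blast
  then show ?thesis by (simp add: mem_box_cart block_def)
qed

lemma prod_Basis_cart: "(\<Prod>b\<in>(Basis :: (real^'a) set). f b) = (\<Prod>a\<in>UNIV. f (axis a 1))"
proof -
  have "(\<Prod>b\<in>(Basis :: (real^'a) set). f b) = (\<Prod>b\<in>range (\<lambda>a::'a. axis a 1). f b)"
    by (rule prod.cong) (auto simp: Basis_vec_def)
  also have "\<dots> = (\<Prod>a\<in>UNIV. f (axis a 1))"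
    by (subst prod.reindex) (auto simp: inj_on_def axis_eq_axis)
  finally show ?thesis .
qed

lemma prod_pos: "(\<Prod>a\<in>UNIV. f (pos (a::'a::{finite,linorder}))) = (\<Prod>q<CARD('a). f q)"
  by (rule prod.reindex_bij_betw[OF bij_betw_pos])

lemma emeasure_box_cart:
  fixes l u :: "'a::{finite,linorder} rvec"
  assumes "\<And>a. l $ a \<le> u $ a"
  shows "emeasure lborel (box l u) = (\<Prod>a\<in>UNIV. ennreal (u $ a - l $ a))"
proof -
  have "emeasure lborel (box l u) = ennreal (\<Prod>b\<in>Basis. (u - l) \<bullet> b)"
    by (rule emeasure_lborel_box) (auto simp: Basis_vec_def inner_axis assms)
  also have "(\<Prod>b\<in>Basis. (u - l) \<bullet> b) = (\<Prod>a\<in>UNIV. u $ a - l $ a)"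
    by (subst prod_Basis_cart) (simp add: inner_axis)
  finally show ?thesis using assms by (simp add: prod_ennreal)
qed

lemma emeasure_box_block:
  fixes l u :: "'i::{finite,linorder} rvec"
  assumes "\<And>e. l $ e \<le> u $ e"
  shows "emeasure lborel (box (block s j l) (block s j u) :: 'a::{finite,linorder} rvec set) =
    (\<Prod>q<CARD('a). ennreal (u $ slot (s + (j * CARD('a) + q)) - l $ slot (s + (j * CARD('a) + q))))"
  by (subst emeasure_box_cart)
     (simp_all add: block_def assms
       prod_pos[of "\<lambda>q. ennreal (u $ slot (s + (j * CARD('a) + q)) - l $ slot (s + (j * CARD('a) + q)))"])

lemma emeasure_PiM_box_blocks:
  fixes l u :: "'i::{finite,linorder} rvec"
  assumes "\<And>e. l $ e \<le> u $ e"
  shows "emeasure (\<Pi>\<^sub>M j\<in>{..<k}. lborel)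
      (\<Pi>\<^sub>E j\<in>{..<k}. (box (block s j l) (block s j u) :: 'a::{finite,linorder} rvec set)) =
    (\<Prod>q<k * CARD('a). ennreal (u $ slot (s + q) - l $ slot (s + q)))"
proof -
  interpret product_sigma_finite "\<lambda>_::nat. lborel :: 'a rvec measure" ..
  have group: "(\<Prod>j<k. \<Prod>q<n. f (j * n + q)) = (\<Prod>q<k * n. f q)" for f :: "nat \<Rightarrow> ennreal" and n
  proof -
    have "(\<Prod>q<n. f (j * n + q)) = prod f {j * n..<j * n + n}" for j
      using prod.shift_bounds_nat_ivl[of f 0 "j * n" n] by (simp add: atLeast0LessThan add.commute)
    then show ?thesis using prod.nat_group[of f n k] by simp
  qed
  have "emeasure (\<Pi>\<^sub>M j\<in>{..<k}. lborel)
      (\<Pi>\<^sub>E j\<in>{..<k}. (box (block s j l) (block s j u) :: 'a rvec set)) =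
      (\<Prod>j<k. emeasure lborel (box (block s j l) (block s j u) :: 'a rvec set))"
    by (intro emeasure_PiM) auto
  also have "\<dots> = (\<Prod>j<k. \<Prod>q<CARD('a). ennreal (u $ slot (s + (j * CARD('a) + q)) - l $ slot (s + (j * CARD('a) + q))))"
    by (simp add: emeasure_box_block assms)
  also have "\<dots> = (\<Prod>q<k * CARD('a). ennreal (u $ slot (s + q) - l $ slot (s + q)))"
    by (rule group)
  finally show ?thesis .
qed

lemma prod_slot: "(\<Prod>e\<in>(UNIV::'i::{finite,linorder} set). f e) = (\<Prod>q<CARD('i). f (slot q))"
  using prod_pos[of "\<lambda>q. f (slot q)", where 'a = 'i] by simp

lemma measurable_vec_lambda:
  assumes "\<And>e. (\<lambda>w. f w e) \<in> borel_measurable M"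
  shows "(\<lambda>w. (\<chi> e. f w e) :: real^'i) \<in> borel_measurable M"
  by (subst borel_measurable_euclidean_space) (auto simp: Basis_vec_def inner_axis assms)

lemma vec_nth_measurable [measurable]: "(\<lambda>x::real^'a. x $ a) \<in> borel_measurable borel"
  by (intro borel_measurable_continuous_onI continuous_intros)

lemma Basis_le_cart: "(\<And>b. b \<in> Basis \<Longrightarrow> l \<bullet> b \<le> u \<bullet> b) \<Longrightarrow> l $ e \<le> (u::real^'i) $ e"
  by (force simp: Basis_vec_def inner_axis dest: meta_spec[of _ "axis e 1"])

lemma component_measurable_PiM:
  assumes "j < k"
  shows "(\<lambda>t. t j $ a) \<in> borel_measurable (\<Pi>\<^sub>M j\<in>{..<k}. (lborel :: (real^'a) measure))"
proof -
  have "(\<lambda>x::real^'a. x $ a) \<in> borel_measurable lborel" by simp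
  then show ?thesis
    by (rule measurable_compose[rotated]) (use assms in \<open>auto intro: measurable_component_singleton\<close>)
qed

lemma glue_measurable:
  assumes "s + k * CARD('a) = CARD('i)"
  shows "(\<lambda>(x, t). glue s x t :: 'i::{finite,linorder} rvec) \<in> borel_measurable
    ((lborel :: 'b::{finite,linorder} rvec measure) \<Otimes>\<^sub>M (\<Pi>\<^sub>M j\<in>{..<k}. (lborel :: 'a::{finite,linorder} rvec measure)))"
proof -
  have "(\<lambda>xt. if pos e < s then fst xt $ slot (pos e)
      else snd xt ((pos e - s) div CARD('a)) $ slot ((pos e - s) mod CARD('a))) \<in> borel_measurable
    ((lborel :: 'b rvec measure) \<Otimes>\<^sub>M (\<Pi>\<^sub>M j\<in>{..<k}. (lborel :: 'a rvec measure)))" for e :: 'i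
  proof (cases "pos e < s")
    case True
    then show ?thesis by simp
  next
    case False
    then have "(pos e - s) div CARD('a) < k"
      using pos_less_card[of e] assms by (intro less_mult_imp_div_less) linarith
    from measurable_compose[OF measurable_snd component_measurable_PiM[OF this]]
    show ?thesis using False by simp
  qed
  then show ?thesis
    unfolding glue_def case_prod_beta by (intro measurable_vec_lambda)
qed

text \<open>The two measures agree on boxes, because a box is the product of its blocks.\<close>

lemma lborel_eq_glue:
  assumes "CARD('b) + k * CARD('a) = CARD('i)"
  shows "(lborel :: 'i::{finite,linorder} rvec measure) =
    distr ((lborel :: 'b::{finite,linorder} rvec measure) \<Otimes>\<^sub>M (\<Pi>\<^sub>M j\<in>{..<k}. (lborel :: 'a::{finite,linorder} rvec measure)))
      borel (\<lambda>(x, t). glue CARD('b) x t)"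
proof (rule lborel_eqI)
  interpret product_sigma_finite "\<lambda>_::nat. lborel :: 'a rvec measure" ..
  interpret fin: finite_product_sigma_finite "\<lambda>_::nat. lborel :: 'a rvec measure" "{..<k}" by standard simp
  fix l u :: "'i rvec" assume "\<And>b. b \<in> Basis \<Longrightarrow> l \<bullet> b \<le> u \<bullet> b"
  then have le: "l $ e \<le> u $ e" for e by (rule Basis_le_cart)
  let ?M = "(lborel :: 'b rvec measure) \<Otimes>\<^sub>M (\<Pi>\<^sub>M j\<in>{..<k}. (lborel :: 'a rvec measure))"
  let ?X = "box (block 0 0 l) (block 0 0 u) :: 'b rvec set"
  let ?T = "\<Pi>\<^sub>E j\<in>{..<k}. (box (block CARD('b) j l) (block CARD('b) j u) :: 'a rvec set)"
  have "CARD('b) \<le> CARD('i)" using assms by linarith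
  then have "(glue CARD('b) x t :: 'i rvec) \<in> box l u \<longleftrightarrow> x \<in> ?X \<and>
      (\<forall>j<k. t j \<in> box (block CARD('b) j l) (block CARD('b) j u))" for x and t :: "nat \<Rightarrow> 'a rvec"
    by (simp add: mem_box_iff_blocks2[OF assms] block_glue[OF assms] block_glue_0)
  then have "(\<lambda>(x, t). glue CARD('b) x t) -` box l u \<inter> space ?M = ?X \<times> ?T"
    by (auto simp: space_pair_measure space_PiM PiE_iff simp del: mem_box_cart)
  then have "emeasure (distr ?M borel (\<lambda>(x, t). glue CARD('b) x t)) (box l u) = emeasure ?M (?X \<times> ?T)"
    by (subst emeasure_distr[OF glue_measurable[OF assms]]) auto
  also have "\<dots> = emeasure lborel ?X * emeasure (\<Pi>\<^sub>M j\<in>{..<k}. lborel) ?T"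
    by (intro fin.emeasure_pair_measure_Times) auto
  also have "emeasure lborel ?X = (\<Prod>q<CARD('b). ennreal (u $ slot q - l $ slot q))"
    using emeasure_box_block[OF le, of 0 0, where 'a = 'b] by simp
  also have "emeasure (\<Pi>\<^sub>M j\<in>{..<k}. lborel) ?T =
      (\<Prod>q<k * CARD('a). ennreal (u $ slot (CARD('b) + q) - l $ slot (CARD('b) + q)))"
    by (rule emeasure_PiM_box_blocks[OF le])
  also have "(\<Prod>q<CARD('b). ennreal (u $ slot q - l $ slot q)) * \<dots> =
      (\<Prod>q<CARD('i). ennreal (u $ slot q - l $ slot q))"
    unfolding assms[symmetric]
    using prod.shift_bounds_nat_ivl[of "\<lambda>q. ennreal (u $ slot q - l $ slot q)" 0 "CARD('b)" "k * CARD('a)"]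
      prod.atLeastLessThan_concat[of 0 "CARD('b)" "CARD('b) + k * CARD('a)" "\<lambda>q. ennreal (u $ slot q - l $ slot q)"]
    by (simp add: atLeast0LessThan add.commute)
  also have "\<dots> = (\<Prod>e\<in>UNIV. ennreal (u $ e - l $ e))"
    by (rule prod_slot[symmetric])
  also have "\<dots> = emeasure lborel (box l u)"
    by (rule emeasure_box_cart[OF le, symmetric])
  also have "\<dots> = ennreal (\<Prod>b\<in>Basis. (u - l) \<bullet> b)"
    by (rule emeasure_lborel_box) fact
  finally show "emeasure (distr ?M borel (\<lambda>(x, t). glue CARD('b) x t)) (box l u) = \<dots>" .
qed simp

lemma sets_blocks_in:
  assumes "F \<in> sets borel"
  shows "{w :: 'i::{finite,linorder} rvec. \<forall>j<k. block s j w \<in> F} \<in> sets borel"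
proof -
  have "block s j -` F \<in> sets (borel :: 'i rvec measure)" for j
    using measurable_sets[OF block_measurable assms] by simp
  moreover have "{w :: 'i rvec. \<forall>j<k. block s j w \<in> F} = (\<Inter>j\<in>{..<k}. block s j -` F) \<inter> UNIV"
    by auto
  ultimately show ?thesis
    by (cases "k = 0") (auto intro!: sets.finite_INT)
qed

lemma emeasure_blocks_in:
  fixes F :: "'a::{finite,linorder} rvec set"
  assumes card: "k * CARD('a) = CARD('i::{finite,linorder})" and F: "F \<in> sets borel"
  shows "emeasure lborel {w :: 'i rvec. \<forall>j<k. block 0 j w \<in> F} = emeasure lborel F ^ k"
proof -
  interpret product_sigma_finite "\<lambda>_::nat. lborel :: 'a rvec measure" ..
  let ?M = "\<Pi>\<^sub>M j\<in>{..<k}. (lborel :: 'a rvec measure)"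
  let ?g = "glue 0 (undefined :: 'a rvec) :: (nat \<Rightarrow> 'a rvec) \<Rightarrow> 'i rvec"
  have card0: "0 + k * CARD('a) = CARD('i)" using card by simp
  have meas: "?g \<in> borel_measurable ?M"
    using measurable_compose[OF measurable_Pair1'[of undefined] glue_measurable[OF card0, where 'b = 'a]] by simp
  have lborel: "lborel = distr ?M borel ?g"
  proof (rule lborel_eqI)
    fix l u :: "'i rvec" assume "\<And>b. b \<in> Basis \<Longrightarrow> l \<bullet> b \<le> u \<bullet> b"
    then have le: "l $ e \<le> u $ e" for e by (rule Basis_le_cart)
    have "?g t \<in> box l u \<longleftrightarrow> (\<forall>j<k. t j \<in> box (block 0 j l) (block 0 j u))" for t
      by (simp add: mem_box_iff_blocks[OF card] block_glue[OF card0])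
    then have "?g -` box l u \<inter> space ?M = (\<Pi>\<^sub>E j\<in>{..<k}. (box (block 0 j l) (block 0 j u) :: 'a rvec set))"
      by (auto simp: space_PiM PiE_iff)
    then have "emeasure (distr ?M borel ?g) (box l u) = (\<Prod>q<CARD('i). ennreal (u $ slot q - l $ slot q))"
      using emeasure_PiM_box_blocks[OF le, of k 0, where 'a = 'a] meas card
      by (subst emeasure_distr) auto
    also have "\<dots> = (\<Prod>e\<in>UNIV. ennreal (u $ e - l $ e))"
      by (rule prod_slot[symmetric])
    also have "\<dots> = emeasure lborel (box l u)"
      by (rule emeasure_box_cart[OF le, symmetric])
    also have "\<dots> = ennreal (\<Prod>b\<in>Basis. (u - l) \<bullet> b)"
      by (rule emeasure_lborel_box) fact
    finally show "emeasure (distr ?M borel ?g) (box l u) = \<dots>" .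
  qed simp
  have "{w :: 'i rvec. \<forall>j<k. block 0 j w \<in> F} \<in> sets borel"
    by (rule sets_blocks_in[OF F])
  then have "emeasure lborel {w :: 'i rvec. \<forall>j<k. block 0 j w \<in> F} =
      emeasure ?M (?g -` {w. \<forall>j<k. block 0 j w \<in> F} \<inter> space ?M)"
    by (subst lborel) (rule emeasure_distr[OF meas])
  also have "?g -` {w. \<forall>j<k. block 0 j w \<in> F} \<inter> space ?M = (\<Pi>\<^sub>E j\<in>{..<k}. F)"
    by (auto simp: block_glue[OF card0] space_PiM PiE_iff)
  also have "emeasure ?M \<dots> = emeasure lborel F ^ k"
    using F by (subst emeasure_PiM) auto
  finally show ?thesis .
qed

section \<open>The integral of the functional\<close>

text \<open>The change of variables needs a well-ordered index type with \<open>k * CARD('m)\<close> elements; since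
  \<open>k = CARD('b) div (CARD('m) - CARD('n))\<close>, that number is determined by the three given types.  The
  maximum only ensures that the type is inhabited for all instances of the type variables.\<close>

typedef ('n, 'm, 'b) conf_index =
  "{..<max 1 (CARD('b) div (CARD('m) - CARD('n)) * CARD('m))} :: nat set"
  by (rule exI[of _ 0]) auto

instantiation conf_index :: (type, type, type) wellorder
begin

definition "less_eq_conf_index (p :: ('a, 'b, 'c) conf_index) (q :: ('a, 'b, 'c) conf_index) \<longleftrightarrow>
  Rep_conf_index p \<le> Rep_conf_index q"
definition "less_conf_index (p :: ('a, 'b, 'c) conf_index) (q :: ('a, 'b, 'c) conf_index) \<longleftrightarrow>
  Rep_conf_index p < Rep_conf_index q"

instance
proof
  fix P :: "('a, 'b, 'c) conf_index \<Rightarrow> bool" and p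
  assume step: "\<And>p. (\<And>q. q < p \<Longrightarrow> P q) \<Longrightarrow> P p"
  show "P p"
    by (induction p rule: measure_induct_rule[of Rep_conf_index])
       (use step in \<open>auto simp: less_conf_index_def\<close>)
qed (auto simp: less_eq_conf_index_def less_conf_index_def Rep_conf_index_inject)

end

instance conf_index :: (type, type, type) finite
proof
  have "finite (Rep_conf_index ` (UNIV :: ('a, 'b, 'c) conf_index set))"
    by (rule finite_subset[of _ "{..<max 1 (CARD('c) div (CARD('b) - CARD('a)) * CARD('b))}"])
       (use Rep_conf_index in auto)
  then show "finite (UNIV :: ('a, 'b, 'c) conf_index set)"
    by (rule finite_imageD) (auto simp: inj_on_def Rep_conf_index_inject)
qed

lemma card_conf_index:
  "CARD(('n, 'm, 'b) conf_index) = max 1 (CARD('b) div (CARD('m) - CARD('n)) * CARD('m))"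
  using type_definition.card[OF type_definition_conf_index] by simp

text \<open>By Fubini the left side is an integral over the space of configurations, of the Jacobian of the
  configuration map over the preimage of \<open>F\<^bsup>k\<^esup>\<close>.\<close>

lemma nn_integral_Phi_le:
  fixes \<gamma> :: "'n::{finite,linorder} rvec \<times> 'b::{finite,linorder} rvec \<Rightarrow> 'm::{finite,linorder} rvec"
  assumes card: "CARD('n) < CARD('m)" "CARD('b) = (CARD('m) - CARD('n)) * k" and k: "0 < k"
    and poly: "polynomial_function \<gamma>" and deg: "poly_map_degree \<gamma> = d"
    and F: "F \<in> sets borel" "emeasure lborel F < \<infinity>"
  defines "I \<equiv> \<lambda>x. \<integral>\<^sup>+ t. indicator {t. \<forall>j<k. \<gamma> (t j, x) \<in> F} t * ennreal \<bar>Phi \<gamma> k x t\<bar> \<partial>(\<Pi>\<^sub>M j\<in>{..<k}. lborel)"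
  shows "I \<in> borel_measurable lborel"
    and "(\<integral>\<^sup>+ x. I x \<partial>lborel) \<le> of_nat (fibre_bound (k * CARD('m)) (DIM('n rvec \<times> 'b rvec) * d)) * emeasure lborel F ^ k"
proof -
  interpret product_sigma_finite "\<lambda>_::nat. lborel :: 'n rvec measure" ..
  interpret fin: finite_product_sigma_finite "\<lambda>_::nat. lborel :: 'n rvec measure" "{..<k}" by standard simp
  have card_i: "CARD(('n, 'm, 'b) conf_index) = k * CARD('m)"
    using card k by (simp add: card_conf_index)
  have total: "CARD('b) + k * CARD('n) = CARD(('n, 'm, 'b) conf_index)"
    unfolding card_i using card by (simp add: diff_mult_distrib mult.commute flip: add_mult_distrib2)
  obtain G where G: "\<And>z. (\<gamma> has_derivative G z) (at z)" "\<And>v. continuous_on UNIV (\<lambda>z. G z v)"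
    using polynomial_function_C1[OF poly] by blast
  define \<Psi> :: "('n, 'm, 'b) conf_index rvec \<Rightarrow> ('n, 'm, 'b) conf_index rvec" where "\<Psi> = configuration_map \<gamma>"
  define J where "J w = \<bar>det (matrix (configuration_deriv G w))\<bar>" for w :: "('n, 'm, 'b) conf_index rvec"
  define A :: "('n, 'm, 'b) conf_index rvec set" where "A = {y. \<forall>j<k. block 0 j y \<in> F}"
  define D where "D = DIM('n rvec \<times> 'b rvec) * d"
  define H where "H w = indicator A (\<Psi> w) * ennreal (J w)" for w
  let ?g = "\<lambda>(x :: 'b rvec, t :: nat \<Rightarrow> 'n rvec). glue CARD('b) x t :: ('n, 'm, 'b) conf_index rvec"

  have der: "(\<Psi> has_derivative configuration_deriv G w) (at w)" for w
    unfolding \<Psi>_def by (rule configuration_map_has_derivative[OF G(1)])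
  have cont: "continuous_on UNIV (\<lambda>w. configuration_deriv G w h :: ('n, 'm, 'b) conf_index rvec)" for h
    by (rule continuous_on_configuration_deriv[OF G(2)])
  have A: "A \<in> sets borel" "emeasure lborel A = emeasure lborel F ^ k"
    unfolding A_def by (rule sets_blocks_in[OF F(1)], rule emeasure_blocks_in[OF card_i[symmetric] F(1)])
  have [measurable]: "\<Psi> \<in> borel_measurable borel" "J \<in> borel_measurable borel"
  proof -
    show "\<Psi> \<in> borel_measurable borel"
      using der by (intro borel_measurable_continuous_onI continuous_at_imp_continuous_on ballI has_derivative_continuous)
    show "J \<in> borel_measurable borel"
      unfolding J_def by (intro borel_measurable_continuous_onI continuous_intros continuous_on_det_matrix cont)
  qed
  have H_meas: "H \<in> borel_measurable borel"
    unfolding H_def using A(1) by measurable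

  have H_glue: "indicator {t. \<forall>j<k. \<gamma> (t j, x) \<in> F} t * ennreal \<bar>Phi \<gamma> k x t\<bar> = H (glue CARD('b) x t)"
    for x and t :: "nat \<Rightarrow> 'n rvec"
  proof -
    let ?w = "glue CARD('b) x t :: ('n, 'm, 'b) conf_index rvec"
    have x: "block 0 0 ?w = x"
      using total by (intro block_glue_0) linarith
    have t: "block CARD('b) j ?w = t j" if "j < k" for j
      by (rule block_glue[OF total that])
    have "\<Psi> ?w \<in> A \<longleftrightarrow> (\<forall>j<k. \<gamma> (t j, x) \<in> F)"
      using block_configuration_map[OF card_i, of _ \<gamma> ?w] x t by (simp add: A_def \<Psi>_def)
    moreover have "J ?w = \<bar>Phi \<gamma> k x t\<bar>"
    proof -
      have "J ?w = \<bar>Phi \<gamma> k (block 0 0 ?w) (\<lambda>j. block CARD('b) j ?w)\<bar>"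
        unfolding J_def by (rule abs_det_configuration_deriv[OF card card_i k G(1)])
      also have "Phi \<gamma> k (block 0 0 ?w) (\<lambda>j. block CARD('b) j ?w) = Phi \<gamma> k x t"
        unfolding Phi_def x
        by (intro arg_cong[where f = "\<lambda>fs. wedge_list fs UNIV"] map_cong refl) (simp add: t)
      finally show ?thesis .
    qed
    ultimately show ?thesis by (simp add: H_def indicator_def)
  qed

  have "coord_poly D (\<lambda>w. \<Psi> w \<bullet> b)" if "b \<in> Basis" for b
  proof -
    from that obtain e where b: "b = axis e 1" by (auto simp: Basis_vec_def)
    let ?L = "\<lambda>w :: ('n, 'm, 'b) conf_index rvec.
      (block CARD('b) (pos e div CARD('m)) w :: 'n rvec, block 0 0 w :: 'b rvec)"
    have "coord_poly D (\<lambda>w. \<gamma> (?L w) \<bullet> axis (slot (pos e mod CARD('m))) 1)"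
      unfolding D_def using polynomial_function_degree[OF poly] deg
      by (intro poly_of_degree_le_compose_linear bounded_linear_Pair bounded_linear_block) simp
    then show ?thesis
      by (simp add: b \<Psi>_def configuration_map_def inner_axis)
  qed
  then have fibres: "AE y in lborel. finite {w. \<Psi> w = y} \<and> card {w. \<Psi> w = y} \<le> fibre_bound (k * CARD('m)) D"
    using AE_card_fibre_le[of D \<Psi>] by (simp add: card_i)

  have I: "I = (\<lambda>x. \<integral>\<^sup>+ t. (\<lambda>xt. H (?g xt)) (x, t) \<partial>(\<Pi>\<^sub>M j\<in>{..<k}. lborel))"
    by (simp add: I_def H_glue)
  show "I \<in> borel_measurable lborel"
    unfolding I by (intro fin.borel_measurable_nn_integral_fst measurable_compose[OF glue_measurable[OF total] H_meas])
  have "(\<integral>\<^sup>+ x. I x \<partial>lborel) = (\<integral>\<^sup>+ x. (\<integral>\<^sup>+ t. (\<lambda>xt. H (?g xt)) (x, t) \<partial>(\<Pi>\<^sub>M j\<in>{..<k}. lborel)) \<partial>lborel)"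
    by (simp only: I)
  also have "\<dots> = (\<integral>\<^sup>+ xt. H (?g xt) \<partial>(lborel \<Otimes>\<^sub>M (\<Pi>\<^sub>M j\<in>{..<k}. lborel)))"
    by (intro fin.nn_integral_fst measurable_compose[OF glue_measurable[OF total] H_meas])
  also have "\<dots> = (\<integral>\<^sup>+ w. H w \<partial>distr (lborel \<Otimes>\<^sub>M (\<Pi>\<^sub>M j\<in>{..<k}. lborel)) borel ?g)"
    by (rule nn_integral_distr[OF glue_measurable[OF total], symmetric]) (simp add: H_meas)
  also have "\<dots> = (\<integral>\<^sup>+ w. H w \<partial>lborel)"
    by (simp only: lborel_eq_glue[OF total, symmetric])
  also have "\<dots> \<le> of_nat (fibre_bound (k * CARD('m)) D) * emeasure lborel A"
    unfolding H_def J_def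
    by (rule nn_integral_Jacobian_le[OF der cont fibres A(1)])
       (use F(2) in \<open>cases "emeasure lborel F"; simp add: A(2) ennreal_power\<close>)
  finally show "(\<integral>\<^sup>+ x. I x \<partial>lborel) \<le>
      of_nat (fibre_bound (k * CARD('m)) (DIM('n rvec \<times> 'b rvec) * d)) * emeasure lborel F ^ k"
    by (simp only: A(2) D_def)
qed

section \<open>The estimate for the Radon-like operator\<close>

lemma epowr_mono:
  assumes "x \<le> y" "0 < p"
  shows "epowr x p \<le> epowr y p"
proof (cases "y = top")
  case False
  then have "x < top" "y < top" using assms(1) by (auto simp: less_top dest: neq_top_trans)
  then show ?thesis
    using assms by (auto simp: epowr_def intro!: ennreal_leI powr_mono2 enn2real_mono)
qed (simp add: epowr_def)

lemma epowr_ennreal: "0 \<le> a \<Longrightarrow> epowr (ennreal a) p = ennreal (a powr p)"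
  by (simp add: epowr_def)

theorem theorem1:
  fixes k d :: nat and s :: real
  assumes "CARD('n::{finite,linorder}) < CARD('m::{finite,linorder})"
    and "0 < k"
    and "CARD('b::{finite,linorder}) = (CARD('m) - CARD('n)) * k"
    and "0 < s"
  shows "\<exists>C::real. 0 < C \<and>
    (\<forall>(\<gamma> :: 'n rvec \<times> 'b rvec \<Rightarrow> 'm rvec) (\<delta>::real) (\<Omega> :: ('n rvec \<times> 'b rvec) set).
      polynomial_function \<gamma> \<longrightarrow> poly_map_degree \<gamma> = d \<longrightarrow> 0 < \<delta> \<longrightarrow> \<Omega> \<in> sets borel \<longrightarrow>
      (\<forall>x. \<forall>E \<in> sets borel. E \<times> {x} \<subseteq> \<Omega> \<longrightarrow>
         (\<integral>\<^sup>+ t \<in> ({..<k} \<rightarrow>\<^sub>E E). ennreal \<bar>Phi \<gamma> k x t\<bar> \<partial>(\<Pi>\<^sub>M j\<in>{..<k}. lborel))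
           \<ge> ennreal \<delta> * epowr (emeasure lborel E) (real k + s)) \<longrightarrow>
      (\<forall>F \<in> sets borel.
         Lp_norm (real k + s) (radon_op \<gamma> \<Omega> (indicator F))
           \<le> ennreal C * ennreal (\<delta> powr (- 1 / (real k + s)))
               * epowr (emeasure lborel F) (real k / (real k + s))))"
proof -
  define p where "p = real k + s"
  define B where "B = fibre_bound (k * CARD('m)) (DIM('n rvec \<times> 'b rvec) * d)"
  define C where "C = real B powr (1 / p)"
  have p: "p > 0" using assms by (simp add: p_def)
  have "B > 0" by (simp add: B_def fibre_bound_def)
  then have C: "C > 0" by (simp add: C_def)
  have "Lp_norm p (radon_op \<gamma> \<Omega> (indicator F)) \<le>
      ennreal C * ennreal (\<delta> powr (- 1 / p)) * epowr (emeasure lborel F) (real k / p)"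
    if poly: "polynomial_function \<gamma>" and deg: "poly_map_degree \<gamma> = d" and \<delta>: "0 < \<delta>"
      and \<Omega>: "\<Omega> \<in> sets borel" and F: "F \<in> sets borel"
      and lower: "\<And>x E. E \<in> sets borel \<Longrightarrow> E \<times> {x} \<subseteq> \<Omega> \<Longrightarrow>
        ennreal \<delta> * epowr (emeasure lborel E) p \<le>
        (\<integral>\<^sup>+ t \<in> ({..<k} \<rightarrow>\<^sub>E E). ennreal \<bar>Phi \<gamma> k x t\<bar> \<partial>(\<Pi>\<^sub>M j\<in>{..<k}. lborel))"
    for \<gamma> :: "'n rvec \<times> 'b rvec \<Rightarrow> 'm rvec" and \<delta> \<Omega> F
  proof (cases "emeasure lborel F = \<infinity>")
    case True
    then show ?thesis
      using C \<delta> p by (simp add: epowr_def ennreal_mult_top)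
  next
    case False
    then obtain \<phi> where \<phi>: "0 \<le> \<phi>" "emeasure lborel F = ennreal \<phi>"
      by (metis ennreal_cases infinity_ennreal_def)
    define Q where "Q x t = indicator {t. \<forall>j<k. \<gamma> (t j, x) \<in> F} t * ennreal \<bar>Phi \<gamma> k x t\<bar>" for x t
    let ?M = "\<Pi>\<^sub>M j\<in>{..<k}. (lborel :: 'n rvec measure)"
    let ?T = "radon_op \<gamma> \<Omega> (indicator F)"
    have \<gamma>_meas: "\<gamma> \<in> borel_measurable borel"
      using poly by (intro borel_measurable_continuous_onI continuous_on_polymonial_function)
    have pointwise: "epowr (?T x) p \<le> ennreal (1 / \<delta>) * (\<integral>\<^sup>+ t. Q x t \<partial>?M)" for x
    proof -
      define E where "E = {t. \<gamma> (t, x) \<in> F \<and> (t, x) \<in> \<Omega>}"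
      have "(\<lambda>t. (t, x)) \<in> borel_measurable borel"
        by (intro borel_measurable_continuous_onI continuous_intros)
      moreover have "\<gamma> -` F \<inter> \<Omega> \<in> sets borel"
        using measurable_sets[OF \<gamma>_meas F] \<Omega> by auto
      ultimately have "(\<lambda>t. (t, x)) -` (\<gamma> -` F \<inter> \<Omega>) \<inter> space borel \<in> sets borel"
        by (rule measurable_sets)
      moreover have "(\<lambda>t. (t, x)) -` (\<gamma> -` F \<inter> \<Omega>) \<inter> space borel = E"
        by (auto simp: E_def)
      ultimately have E: "E \<in> sets borel" by simp
      have "?T x = (\<integral>\<^sup>+ t. indicator E t \<partial>lborel)"
        unfolding radon_op_def by (intro nn_integral_cong) (auto simp: E_def indicator_def)
      then have T: "?T x = emeasure lborel E" using E by simp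
      have "ennreal \<delta> * epowr (?T x) p \<le>
          (\<integral>\<^sup>+ t \<in> ({..<k} \<rightarrow>\<^sub>E E). ennreal \<bar>Phi \<gamma> k x t\<bar> \<partial>?M)"
        unfolding T by (rule lower[OF E]) (auto simp: E_def)
      also have "\<dots> \<le> (\<integral>\<^sup>+ t. Q x t \<partial>?M)"
        by (intro nn_integral_mono) (auto simp: Q_def E_def indicator_def PiE_iff)
      finally have "ennreal (1 / \<delta>) * (ennreal \<delta> * epowr (?T x) p) \<le> ennreal (1 / \<delta>) * (\<integral>\<^sup>+ t. Q x t \<partial>?M)"
        by (rule mult_left_mono) simp
      moreover have "ennreal (1 / \<delta>) * (ennreal \<delta> * epowr (?T x) p) = epowr (?T x) p"
        using \<delta> by (simp add: mult.assoc[symmetric] ennreal_mult'[symmetric])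
      ultimately show ?thesis by simp
    qed
    have fin: "emeasure lborel F < \<infinity>" using False by (simp add: less_top)
    have "(\<integral>\<^sup>+ x. epowr (?T x) p \<partial>lborel) \<le> (\<integral>\<^sup>+ x. ennreal (1 / \<delta>) * (\<integral>\<^sup>+ t. Q x t \<partial>?M) \<partial>lborel)"
      by (intro nn_integral_mono pointwise)
    also have "\<dots> = ennreal (1 / \<delta>) * (\<integral>\<^sup>+ x. (\<integral>\<^sup>+ t. Q x t \<partial>?M) \<partial>lborel)"
      unfolding Q_def by (rule nn_integral_cmult[OF nn_integral_Phi_le(1)[OF assms(1,3,2) poly deg F fin]])
    also have "\<dots> \<le> ennreal (1 / \<delta>) * (of_nat B * emeasure lborel F ^ k)"
      unfolding Q_def B_def
      by (rule mult_left_mono[OF nn_integral_Phi_le(2)[OF assms(1,3,2) poly deg F fin]]) simp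
    also have "\<dots> = ennreal (1 / \<delta> * (real B * \<phi> ^ k))"
    proof -
      have "of_nat B * emeasure lborel F ^ k = ennreal (real B * \<phi> ^ k)"
        using \<phi> by (simp add: ennreal_power ennreal_of_nat_eq_real_of_nat ennreal_mult)
      then show ?thesis
        using \<delta> by (simp only:) (rule ennreal_mult'[symmetric], simp)
    qed
    finally have "Lp_norm p ?T \<le> epowr (ennreal (1 / \<delta> * (real B * \<phi> ^ k))) (1 / p)"
      unfolding Lp_norm_def using p by (intro epowr_mono) auto
    also have "\<dots> = ennreal ((1 / \<delta> * (real B * \<phi> ^ k)) powr (1 / p))"
      using \<phi> \<delta> by (intro epowr_ennreal) simp
    also have "(1 / \<delta> * (real B * \<phi> ^ k)) powr (1 / p) = C * \<delta> powr (- 1 / p) * \<phi> powr (real k / p)"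
    proof -
      have "(\<phi> ^ k) powr (1 / p) = \<phi> powr (real k / p)"
        using \<phi>(1) assms(2)
        by (cases "\<phi> = 0") (simp_all add: powr_powr flip: powr_realpow)
      moreover have "(1 / \<delta>) powr (1 / p) = \<delta> powr (- 1 / p)"
        using \<delta> by (simp add: powr_divide powr_minus_divide)
      moreover have "(1 / \<delta> * (real B * \<phi> ^ k)) powr (1 / p) =
          (1 / \<delta>) powr (1 / p) * (real B powr (1 / p) * (\<phi> ^ k) powr (1 / p))"
        using \<phi>(1) \<delta> by (simp only: powr_mult)
      ultimately show ?thesis
        by (simp add: C_def mult_ac)
    qed
    also have "ennreal \<dots> = ennreal C * ennreal (\<delta> powr (- 1 / p)) * epowr (emeasure lborel F) (real k / p)"
      using C by (simp add: \<phi> epowr_ennreal ennreal_mult)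
    finally show ?thesis .
  qed
  with C show ?thesis
    unfolding p_def by (intro exI[of _ C]) auto
qed

end
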